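(* Let $\Delta$ be a flag $3$-dimensional Eulerian complex on $n$ vertices. If $f_1(\Delta)=f_1(J_2(n))$, then $\Delta\in GJ(n)$.
   Context: A simplicial complex is flag if every minimal non-face has exactly two elements. For a face $\sigma$, $\mathrm{lk}_\Delta\sigma=\{\tau-\sigma:\sigma\subseteq\tau\in\Delta\}$. The reduced Euler characteristic is $\chi(\Gamma)=\sum_i(-1)^i\beta_i(\Gamma;\mathbf{k})$. A complex $\Delta$ is Eulerian if it is pure and $\chi(\mathrm{lk}_\Delta\sigma)=(-1)^{\dim\mathrm{lk}_\Delta\sigma}$ for every face $\sigma$, including $\sigma=\emptyset$. $f_1$ counts edges. $J_2(n)$ is the join of two cycles with $\lfloor n/2\rfloor$ and $\lceil n/2\rceil$ vertices, so $f_1(J_2(n))=\lfloor n^2/4\rfloor+n$. For $n\ge 8$, $GJ(n)$ is the set of all complexes of the form $\Delta=\bigcup_{1\le i\le s,\,1\le j\le t}(C_{a_i}*C_{b_j})$, where $C_k$ denotes a cycle (circle) with $k$ vertices, all the cycles $C_{a_1},\dots,C_{a_s},C_{b_1},\dots,C_{b_t}$ have pairwise disjoint vertex sets, all $a_i,b_j\ge 4$, $\sum_i a_i=\lfloor n/2\rfloor$ and $\sum_j b_j=\lceil n/2\rceil$; equivalently, $\Delta$ is the join of a disjoint union of cycles of lengths $a_1,\dots,a_s$ with a disjoint union of cycles of lengths $b_1,\dots,b_t$. *)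

theory Defs
  imports Complex_Main "HOL-Library.Function_Algebras" "HOL-Library.Disjoint_Sets"
begin

definition is_simplicial_complex :: "'a set set \<Rightarrow> bool" where
  "is_simplicial_complex \<Delta> \<longleftrightarrow>
     finite \<Delta> \<and> (\<forall>\<sigma>\<in>\<Delta>. finite \<sigma>) \<and> {} \<in> \<Delta> \<and> (\<forall>\<sigma>\<in>\<Delta>. \<forall>\<tau>. \<tau> \<subseteq> \<sigma> \<longrightarrow> \<tau> \<in> \<Delta>)"

definition vertex_set :: "'a set set \<Rightarrow> 'a set" where
  "vertex_set \<Delta> = \<Union>\<Delta>"

definition face_dim :: "'a set \<Rightarrow> int" where
  "face_dim \<sigma> = int (card \<sigma>) - 1"

definition complex_dim :: "'a set set \<Rightarrow> int" where
  "complex_dim \<Delta> = Max (face_dim ` \<Delta>)"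

definition edge_count :: "'a set set \<Rightarrow> nat" where
  "edge_count \<Delta> = card {\<sigma>\<in>\<Delta>. face_dim \<sigma> = 1}"

definition minimal_nonface :: "'a set set \<Rightarrow> 'a set \<Rightarrow> bool" where
  "minimal_nonface \<Delta> \<sigma> \<longleftrightarrow> \<sigma> \<subseteq> vertex_set \<Delta> \<and> \<sigma> \<notin> \<Delta> \<and> (\<forall>\<tau>. \<tau> \<subset> \<sigma> \<longrightarrow> \<tau> \<in> \<Delta>)"

definition flag_complex :: "'a set set \<Rightarrow> bool" where
  "flag_complex \<Delta> \<longleftrightarrow> (\<forall>\<sigma>. minimal_nonface \<Delta> \<sigma> \<longrightarrow> card \<sigma> = 2)"

definition facet :: "'a set set \<Rightarrow> 'a set \<Rightarrow> bool" where
  "facet \<Delta> \<sigma> \<longleftrightarrow> \<sigma> \<in> \<Delta> \<and> (\<forall>\<tau>\<in>\<Delta>. \<sigma> \<subseteq> \<tau> \<longrightarrow> \<tau> = \<sigma>)"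

definition pure_complex :: "'a set set \<Rightarrow> bool" where
  "pure_complex \<Delta> \<longleftrightarrow> (\<forall>\<sigma>. facet \<Delta> \<sigma> \<longrightarrow> face_dim \<sigma> = complex_dim \<Delta>)"

definition face_link :: "'a set set \<Rightarrow> 'a set \<Rightarrow> 'a set set" where
  "face_link \<Delta> \<sigma> = {\<tau> - \<sigma> | \<tau>. \<sigma> \<subseteq> \<tau> \<and> \<tau> \<in> \<Delta>}"

text \<open>
  The vertices are oriented by an arbitrary but fixed well-order of the vertex type;
  the Betti numbers do not depend on this choice.
\<close>

definition vertex_order :: "'a rel" where
  "vertex_order = (SOME r. well_order_on UNIV r)"

text \<open>
  A chain is its coefficient function on faces. Since \<open>{}\<close> is a face (of dimension \<open>-1\<close>), the
  chain complex is augmented and its homology is reduced homology.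
\<close>

definition simplicial_chains :: "'a set set \<Rightarrow> int \<Rightarrow> ('a set \<Rightarrow> 'k::field) set" where
  "simplicial_chains \<Delta> i = {c. \<forall>\<sigma>. c \<sigma> \<noteq> 0 \<longrightarrow> \<sigma> \<in> \<Delta> \<and> face_dim \<sigma> = i}"

text \<open>
  The coefficient of \<open>\<tau>\<close> in \<open>\<partial>c\<close> collects the contributions of all faces \<open>\<tau> \<union> {v}\<close>; the sign is
  \<open>-1\<close> to the power of the position (counted from 0) of \<open>v\<close> among the ordered vertices of
  \<open>\<tau> \<union> {v}\<close>.
\<close>

definition simplicial_boundary :: "'a set set \<Rightarrow> ('a set \<Rightarrow> 'k::field) \<Rightarrow> 'a set \<Rightarrow> 'k" where
  "simplicial_boundary \<Delta> c \<tau> =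
     (\<Sum>v\<in>vertex_set \<Delta> - \<tau>. (- 1) ^ card {u\<in>\<tau>. (u, v) \<in> vertex_order} * c (insert v \<tau>))"

definition simplicial_cycles :: "'a set set \<Rightarrow> int \<Rightarrow> ('a set \<Rightarrow> 'k::field) set" where
  "simplicial_cycles \<Delta> i = {c \<in> simplicial_chains \<Delta> i. simplicial_boundary \<Delta> c = 0}"

definition simplicial_boundaries :: "'a set set \<Rightarrow> int \<Rightarrow> ('a set \<Rightarrow> 'k::field) set" where
  "simplicial_boundaries \<Delta> i = simplicial_boundary \<Delta> ` simplicial_chains \<Delta> (i + 1)"

lemma chain_vector_space:
  "vector_space (\<lambda>(r::'k::field) (c::'a set \<Rightarrow> 'k) \<sigma>. r * c \<sigma>)"
  by unfold_locales (auto simp: fun_eq_iff algebra_simps)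

definition chain_space_dim :: "('a set \<Rightarrow> 'k::field) set \<Rightarrow> nat" where
  "chain_space_dim = vector_space.dim (\<lambda>(r::'k) c \<sigma>. r * c \<sigma>)"

definition reduced_betti :: "'k::field itself \<Rightarrow> 'a set set \<Rightarrow> int \<Rightarrow> int" where
  "reduced_betti _ \<Delta> i =
     int (chain_space_dim (simplicial_cycles \<Delta> i :: ('a set \<Rightarrow> 'k) set))
     - int (chain_space_dim (simplicial_boundaries \<Delta> i :: ('a set \<Rightarrow> 'k) set))"

definition neg_one_pow :: "int \<Rightarrow> int" where
  "neg_one_pow i = (if even i then 1 else - 1)"

definition reduced_euler_char :: "'k::field itself \<Rightarrow> 'a set set \<Rightarrow> int" where
  "reduced_euler_char k \<Gamma> = (\<Sum>i = - 1..complex_dim \<Gamma>. neg_one_pow i * reduced_betti k \<Gamma> i)"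

definition eulerian_complex :: "'k::field itself \<Rightarrow> 'a set set \<Rightarrow> bool" where
  "eulerian_complex k \<Delta> \<longleftrightarrow>
     pure_complex \<Delta> \<and>
     (\<forall>\<sigma>\<in>\<Delta>. reduced_euler_char k (face_link \<Delta> \<sigma>) = neg_one_pow (complex_dim (face_link \<Delta> \<sigma>)))"

text \<open>Only used for complexes with disjoint vertex sets.\<close>

definition complex_join :: "'a set set \<Rightarrow> 'a set set \<Rightarrow> 'a set set" where
  "complex_join \<Gamma> \<Delta> = {\<sigma> \<union> \<tau> | \<sigma> \<tau>. \<sigma> \<in> \<Gamma> \<and> \<tau> \<in> \<Delta>}"

definition cycle_complex :: "'a list \<Rightarrow> 'a set set" where
  "cycle_complex xs = {{}} \<union> (\<lambda>x. {x}) ` set xs \<union>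
     {{xs ! i, xs ! (Suc i mod length xs)} | i. i < length xs}"

definition is_cycle :: "nat \<Rightarrow> 'a set set \<Rightarrow> bool" where
  "is_cycle k C \<longleftrightarrow> k \<ge> 3 \<and> (\<exists>xs. distinct xs \<and> length xs = k \<and> C = cycle_complex xs)"

text \<open>Meaningful for \<open>n \<ge> 6\<close>, where both factors are cycles.\<close>

definition J2 :: "nat \<Rightarrow> nat set set" where
  "J2 n = complex_join (cycle_complex [0..<n div 2]) (cycle_complex [n div 2..<n])"

definition GJ :: "nat \<Rightarrow> 'a set set set" where
  "GJ n = {\<Delta>. n \<ge> 8 \<and>
     (\<exists>(s::nat) (t::nat) a b A B.
        (\<forall>i\<in>{1..s}. a i \<ge> 4 \<and> is_cycle (a i) (A i)) \<and>
        (\<forall>j\<in>{1..t}. b j \<ge> 4 \<and> is_cycle (b j) (B j)) \<and>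
        disjoint_family_on (\<lambda>i. vertex_set (A i)) {1..s} \<and>
        disjoint_family_on (\<lambda>j. vertex_set (B j)) {1..t} \<and>
        (\<forall>i\<in>{1..s}. \<forall>j\<in>{1..t}. vertex_set (A i) \<inter> vertex_set (B j) = {}) \<and>
        (\<Sum>i = 1..s. a i) = n div 2 \<and>
        (\<Sum>j = 1..t. b j) = (n + 1) div 2 \<and>
        \<Delta> = (\<Union>i\<in>{1..s}. \<Union>j\<in>{1..t}. complex_join (A i) (B j)))}"

end

theory Submission
  imports Defs
begin

text \<open>
  Work in the 1-skeleton on \<open>n\<close> vertices; since \<open>\<Delta>\<close> is flag, faces are cliques. No vertex is adjacent
  to all of a facet \<open>\<sigma>\<close>, and exactly four outside vertices are adjacent to three vertices of \<open>\<sigma>\<close>, so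
  the degrees over \<open>\<sigma>\<close> sum to at most \<open>2n + 8\<close>. A vertex of degree \<open>d\<close> lies in \<open>2d - 4\<close> facets, and
  summing over all facets with \<open>(d - q)(d - q - 1) \<ge> 0\<close>, where \<open>q = \<lfloor>n/2\<rfloor> + 2\<close>, shows that the assumed
  number of edges forces equality for every facet: each vertex is adjacent to at least two vertices
  of each facet.

  Consequently, inside the link of a vertex of degree \<open>d\<close>, the three degrees over a triangle sum to
  \<open>d + 6\<close>. Each of them is at least 4, so their reciprocals sum to at most \<open>1/2 + 1/(d - 2)\<close>; on the
  other hand the total over the \<open>2d - 4\<close> triangles of the link is \<open>d\<close>, which is the sum of these
  bounds. So two of the three degrees are always 4. Hence every facet has two opposite edges whose links
  have complementary vertex sets, and the complex is the join of two such edge links, which are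
  2-regular graphs, that is, disjoint unions of cycles.

  Of homology only the Euler-Poincare formula for links is needed.
\<close>

section \<open>The Euler-Poincare formula\<close>

text \<open>A basis of the kernel is extended to a basis of \<open>C\<close>, and \<open>f\<close>
  maps the added vectors to a basis of the image. The statement is relative to a finitely spanned
  subspace \<open>C\<close>, because the space of all functions on sets may have infinite
  dimension.\<close>

lemma rank_nullity:
  assumes lin: "Vector_Spaces.linear s1 s2 f"
    and C: "module.subspace s1 C"
    and W: "finite W" "C \<subseteq> module.span s1 W"
  shows "vector_space.dim s1 C =
    vector_space.dim s1 {x \<in> C. f x = 0} + vector_space.dim s2 (f ` C)"
proof -
  interpret Vector_Spaces.linear s1 s2 f by fact
  let ?Z = "{x \<in> C. f x = 0}"
  have Z: "vs1.subspace ?Z"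
    using C unfolding vs1.subspace_def by (auto simp: add scale)
  obtain B0 where B0: "B0 \<subseteq> ?Z" "vs1.independent B0" "?Z \<subseteq> vs1.span B0"
    using vs1.maximal_independent_subset[of ?Z] by blast
  have "B0 \<subseteq> C" using B0(1) by auto
  then obtain B where B: "B0 \<subseteq> B" "B \<subseteq> C" "vs1.independent B" "C \<subseteq> vs1.span B"
    using vs1.maximal_independent_subset_extend[of B0 C] B0(2) by blast
  have finB: "finite B"
    using vs1.independent_span_bound[OF W(1) B(3)] B(2) W(2) by blast
  define D where "D = B - B0"
  have D: "D \<subseteq> B" "vs1.independent D"
    using vs1.independent_mono[OF B(3)] by (auto simp: D_def)
  have spB: "vs1.span B = C" using B C by (metis vs1.span_subspace)
  \<comment> \<open>A kernel element in the span of \<open>D\<close> also lies in the span of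
    \<open>B0\<close>. Its coordinates in \<open>B\<close> are supported on both of these disjoint
    sets, so they vanish.\<close>
  have inj: "inj_on f (vs1.span D)"
    unfolding inj_on_iff_eq_0[OF vs1.subspace_span]
  proof safe
    fix x assume x: "x \<in> vs1.span D" "f x = 0"
    then have "x \<in> C" using vs1.span_mono[OF D(1)] spB by auto
    then have x0: "x \<in> vs1.span B0" using x B0(3) by auto
    have "vs1.representation B x = vs1.representation D x"
      using vs1.representation_extend[OF B(3) x(1) D(1)] .
    moreover have "vs1.representation B x = vs1.representation B0 x"
      using vs1.representation_extend[OF B(3) x0 B(1)] .
    ultimately have "vs1.representation B x b = 0" for b
      using vs1.representation_ne_zero[of D x b] vs1.representation_ne_zero[of B0 x b]
      unfolding D_def by (metis DiffD2)
    moreover have "(\<Sum>b | vs1.representation B x b \<noteq> 0. s1 (vs1.representation B x b) b) = x"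
      using vs1.sum_nonzero_representation_eq[OF B(3)] \<open>x \<in> C\<close> spB by simp
    ultimately show "x = 0" by simp
  qed
  have indep: "vs2.independent (f ` D)"
    using independent_injective_image[OF D(2) inj] .
  have "f ` C \<subseteq> vs2.span (f ` D)"
  proof -
    have "f ` B \<subseteq> vs2.span (f ` D)"
    proof
      fix y assume "y \<in> f ` B"
      then obtain b where b: "b \<in> B" "y = f b" by auto
      show "y \<in> vs2.span (f ` D)"
      proof (cases "b \<in> B0")
        case True
        then have "y = 0" using b B0(1) by auto
        then show ?thesis by (simp add: vs2.span_zero)
      next
        case False
        then show ?thesis using b by (auto simp: D_def intro: vs2.span_base)
      qed
    qed
    then have "vs2.span (f ` B) \<subseteq> vs2.span (f ` D)"
      by (simp add: vs2.span_minimal)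
    then show ?thesis using span_image[of B] spB by simp
  qed
  moreover have "f ` D \<subseteq> f ` C" using D B by auto
  ultimately have "vs2.dim (f ` C) = card (f ` D)"
    using indep vs2.basis_card_eq_dim by metis
  also have "\<dots> = card D"
    using inj vs1.span_superset by (intro card_image) (rule inj_on_subset)
  finally have "vs2.dim (f ` C) = card D" .
  moreover have "vs1.dim C = card B" using B vs1.basis_card_eq_dim by metis
  moreover have "vs1.dim ?Z = card B0" using B0 vs1.basis_card_eq_dim by metis
  moreover have "card B = card B0 + card D"
    using card_Un_disjoint[of B0 D] finB B(1)
    by (metis D_def Diff_disjoint Un_Diff_cancel Un_absorb1 finite_Diff finite_subset)
  ultimately show ?thesis by simp
qed

abbreviation (input) chain_scale :: "'k::field \<Rightarrow> ('a set \<Rightarrow> 'k) \<Rightarrow> 'a set \<Rightarrow> 'k" where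
  "chain_scale \<equiv> \<lambda>r c \<sigma>. r * c \<sigma>"

lemma linear_simplicial_boundary:
  "Vector_Spaces.linear (chain_scale :: 'k::field \<Rightarrow> _) chain_scale (simplicial_boundary \<Delta>)"
  unfolding module_hom_iff_linear[symmetric] module_hom_iff module_iff_vector_space
  by (auto simp: chain_vector_space simplicial_boundary_def fun_eq_iff algebra_simps
      sum.distrib sum_distrib_left)

lemma subspace_simplicial_chains:
  "module.subspace (chain_scale :: 'k::field \<Rightarrow> _) (simplicial_chains \<Delta> i)"
proof -
  interpret vector_space "chain_scale :: 'k \<Rightarrow> _" by (rule chain_vector_space)
  show ?thesis
    unfolding subspace_def simplicial_chains_def
    by auto (metis add_0)+
qed

text \<open>The indicator functions of the faces of dimension \<open>i\<close> form a basis. The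
  first and third parts supply the finite spanning set required by
  \<open>rank_nullity\<close>.\<close>

lemma simplicial_chains_basis:
  fixes \<Delta> :: "'a set set" and i :: int
  assumes fin: "finite \<Delta>"
  defines "b \<equiv> \<lambda>\<sigma> \<tau>. if \<tau> = \<sigma> then 1 else (0::'k::field)"
  defines "F \<equiv> {\<sigma> \<in> \<Delta>. face_dim \<sigma> = i}"
  shows "finite (b ` F)" "b ` F \<subseteq> simplicial_chains \<Delta> i"
    "(simplicial_chains \<Delta> i :: ('a set \<Rightarrow> 'k) set) \<subseteq> module.span chain_scale (b ` F)"
    "chain_space_dim (simplicial_chains \<Delta> i :: ('a set \<Rightarrow> 'k) set) = card F"
proof -
  interpret vector_space "chain_scale :: 'k \<Rightarrow> ('a set \<Rightarrow> 'k) \<Rightarrow> _" by (rule chain_vector_space)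
  have finF: "finite F" using fin by (simp add: F_def)
  show 1: "finite (b ` F)" using finF by simp
  show 2: "b ` F \<subseteq> simplicial_chains \<Delta> i"
    by (auto simp: b_def F_def simplicial_chains_def split: if_splits)
  have injb: "inj_on b F" by (auto simp: inj_on_def b_def fun_eq_iff split: if_splits)
  \<comment> \<open>Evaluating a combination at a face reads off its coefficient; this yields both
    spanning and independence.\<close>
  have sum_apply: "(\<Sum>\<sigma>\<in>F. (\<lambda>\<tau>. u \<sigma> * b \<sigma> \<tau>)) \<tau> = (if \<tau> \<in> F then u \<tau> else 0)" for u \<tau>
  proof -
    have "(\<Sum>\<sigma>\<in>F. (\<lambda>\<tau>. u \<sigma> * b \<sigma> \<tau>)) \<tau> = (\<Sum>\<sigma>\<in>F. u \<sigma> * b \<sigma> \<tau>)"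
      using finF by (induction F rule: finite_induct) auto
    also have "\<dots> = (\<Sum>\<sigma>\<in>F. if \<tau> = \<sigma> then u \<sigma> else 0)"
      by (rule sum.cong) (auto simp: b_def)
    also have "\<dots> = (if \<tau> \<in> F then u \<tau> else 0)" using finF by simp
    finally show ?thesis .
  qed
  show 3: "(simplicial_chains \<Delta> i :: ('a set \<Rightarrow> 'k) set) \<subseteq> span (b ` F)"
  proof
    fix c :: "'a set \<Rightarrow> 'k" assume c: "c \<in> simplicial_chains \<Delta> i"
    have "c \<tau> = (\<Sum>\<sigma>\<in>F. (\<lambda>\<tau>. c \<sigma> * b \<sigma> \<tau>)) \<tau>" for \<tau>
      using c unfolding sum_apply by (auto simp: F_def simplicial_chains_def)
    then have "c = (\<Sum>\<sigma>\<in>F. (\<lambda>\<tau>. c \<sigma> * b \<sigma> \<tau>))" by (rule ext)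
    moreover have "(\<Sum>\<sigma>\<in>F. (\<lambda>\<tau>. c \<sigma> * b \<sigma> \<tau>)) \<in> span (b ` F)"
      by (intro span_sum span_scale span_base) auto
    ultimately show "c \<in> span (b ` F)" by simp
  qed
  have "independent (b ` F)"
  proof (rule independent_if_scalars_zero[OF 1])
    fix u x assume s: "(\<Sum>x\<in>b ` F. (\<lambda>\<sigma>. u x * x \<sigma>)) = 0" and x: "x \<in> b ` F"
    then obtain \<sigma> where \<sigma>: "\<sigma> \<in> F" "x = b \<sigma>" by auto
    have "(\<Sum>\<sigma>\<in>F. (\<lambda>\<tau>. u (b \<sigma>) * b \<sigma> \<tau>)) = 0"
      using s by (simp add: sum.reindex[OF injb])
    then have "(\<Sum>\<sigma>\<in>F. (\<lambda>\<tau>. u (b \<sigma>) * b \<sigma> \<tau>)) \<sigma> = 0" by simp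
    then show "u x = 0" unfolding sum_apply using \<sigma> by simp
  qed
  then show "chain_space_dim (simplicial_chains \<Delta> i :: ('a set \<Rightarrow> 'k) set) = card F"
    unfolding chain_space_dim_def
    using basis_card_eq_dim[OF 2 3] card_image[OF injb] by simp
qed

text \<open>By rank-nullity the number of faces of dimension \<open>i\<close> is
  \<open>z i + b (i - 1)\<close>, where \<open>z\<close> and \<open>b\<close> are the dimensions of
  the spaces of cycles and boundaries. The two alternating sums then differ only by end terms, which
  vanish.\<close>

theorem euler_poincare:
  fixes \<Delta> :: "'a set set"
  assumes \<Delta>: "is_simplicial_complex \<Delta>"
  shows "reduced_euler_char TYPE('k::field) \<Delta> =
    (\<Sum>i = -1..complex_dim \<Delta>. neg_one_pow i * int (card {\<sigma> \<in> \<Delta>. face_dim \<sigma> = i}))"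
proof -
  define d where "d = complex_dim \<Delta>"
  define z where "z i = int (chain_space_dim (simplicial_cycles \<Delta> i :: ('a set \<Rightarrow> 'k) set))" for i
  define b where "b i = int (chain_space_dim (simplicial_boundaries \<Delta> i :: ('a set \<Rightarrow> 'k) set))" for i
  have fin: "finite \<Delta>" and ne: "\<Delta> \<noteq> {}" using \<Delta> by (auto simp: is_simplicial_complex_def)
  interpret vector_space "chain_scale :: 'k \<Rightarrow> ('a set \<Rightarrow> 'k) \<Rightarrow> _" by (rule chain_vector_space)
  have rn: "int (card {\<sigma> \<in> \<Delta>. face_dim \<sigma> = i}) = z i + b (i - 1)" for i
    using rank_nullity[OF linear_simplicial_boundary[of \<Delta>] subspace_simplicial_chains[of \<Delta> i]
        simplicial_chains_basis(1,3)[OF fin, where 'k = 'k and i = i]]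
    unfolding z_def b_def simplicial_cycles_def simplicial_boundaries_def
      simplicial_chains_basis(4)[OF fin, symmetric, where 'k = 'k] chain_space_dim_def
    by simp
  have dim_le: "face_dim \<sigma> \<le> d" if "\<sigma> \<in> \<Delta>" for \<sigma>
    using fin that by (simp add: d_def complex_dim_def)
  have "face_dim ({} :: 'a set) \<le> d" using \<Delta> by (intro dim_le) (simp add: is_simplicial_complex_def)
  then have dm1: "- 1 \<le> d" by (simp add: face_dim_def)
  \<comment> \<open>Above the top dimension there are no faces, so two nonnegative dimensions add up
    to 0 and \<open>b d\<close> is one of them.\<close>
  have "{\<sigma> \<in> \<Delta>. face_dim \<sigma> = d + 1} = {}" using dim_le by force
  then have "z (d + 1) + b d = 0"
    using rn[of "d + 1", symmetric] by (metis add_diff_cancel_right' card.empty of_nat_0)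
  then have bd: "b d = 0" by (simp add: z_def b_def)
  \<comment> \<open>A chain of degree -1 lives on the empty face alone, while the boundary formula
    only reads sets of the form \<open>insert v \<tau>\<close>. Finiteness of faces matters, since
    infinite sets also have \<open>card\<close> 0.\<close>
  have bm2: "b (- 2) = 0"
  proof -
    have "simplicial_boundary \<Delta> c = (0 :: 'a set \<Rightarrow> 'k)" if c: "c \<in> simplicial_chains \<Delta> (- 1)" for c
    proof
      fix \<tau>
      have "c (insert v \<tau>) = 0" if "v \<in> vertex_set \<Delta> - \<tau>" for v
      proof (rule ccontr)
        assume "c (insert v \<tau>) \<noteq> 0"
        then have 1: "insert v \<tau> \<in> \<Delta>" "card (insert v \<tau>) = 0"
          using c by (auto simp: simplicial_chains_def face_dim_def)
        then have "finite (insert v \<tau>)" using \<Delta> unfolding is_simplicial_complex_def by blast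
        then show False using 1(2) by (metis card_0_eq insert_not_empty)
      qed
      then show "simplicial_boundary \<Delta> c \<tau> = 0 \<tau>" by (simp add: simplicial_boundary_def)
    qed
    moreover have "(0 :: 'a set \<Rightarrow> 'k) \<in> simplicial_chains \<Delta> (- 1)"
      by (simp add: simplicial_chains_def)
    ultimately have "(simplicial_boundaries \<Delta> (- 2) :: ('a set \<Rightarrow> 'k) set) = {0}"
      by (force simp: simplicial_boundaries_def)
    moreover have "dim {0 :: 'a set \<Rightarrow> 'k} = 0"
      using dim_le_card[of "{0}" "{}"] by simp
    ultimately show ?thesis by (simp add: b_def chain_space_dim_def)
  qed
  \<comment> \<open>For a general upper limit \<open>e\<close> the last boundary term remains; it
    disappears at \<open>e = d\<close>.\<close>
  have telescope: "(\<Sum>i = -1..e. neg_one_pow i * (z i - b i)) =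
      (\<Sum>i = -1..e. neg_one_pow i * (z i + b (i - 1))) - neg_one_pow e * b e" if "- 1 \<le> e" for e
    using that
  proof (induction e rule: int_ge_induct)
    case base
    then show ?case using bm2 by (simp add: neg_one_pow_def)
  next
    case (step e)
    have *: "{- 1..e + 1} = insert (e + 1) {- 1..e}" using step.hyps by auto
    have "neg_one_pow (e + 1) = - neg_one_pow e" by (simp add: neg_one_pow_def)
    then show ?case unfolding * using step.IH by (simp add: algebra_simps)
  qed
  show ?thesis
    unfolding reduced_euler_char_def reduced_betti_def rn
    using telescope[OF dm1] bd by (simp add: d_def z_def b_def)
qed

section \<open>Reciprocal sums\<close>

text \<open>The difference of the two sides is a positive multiple of
  \<open>(p - 4) * (q - 4)\<close>: with the sum fixed, pushing one number down to 4 does not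
  decrease the sum of the reciprocals, and equality means that one of them is 4 already.\<close>

lemma reciprocal_sum_le:
  fixes p q :: real
  assumes "p \<ge> 4" "q \<ge> 4"
  shows "1 / p + 1 / q \<le> 1 / 4 + 1 / (p + q - 4)"
    and "1 / p + 1 / q = 1 / 4 + 1 / (p + q - 4) \<Longrightarrow> p = 4 \<or> q = 4"
proof -
  have *: "1 / 4 + 1 / (p + q - 4) - (1 / p + 1 / q)
      = (p + q) * ((p - 4) * (q - 4)) / (4 * (p + q - 4) * p * q)"
    using assms by (simp add: field_simps)
  have pos: "4 * (p + q - 4) * p * q > 0" using assms by (intro mult_pos_pos) auto
  show "1 / p + 1 / q \<le> 1 / 4 + 1 / (p + q - 4)"
    using * pos assms by (smt (verit) divide_nonneg_pos mult_nonneg_nonneg)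
  show "p = 4 \<or> q = 4" if "1 / p + 1 / q = 1 / 4 + 1 / (p + q - 4)"
    using * pos assms that by auto
qed

text \<open>Two shifts by \<open>reciprocal_sum_le\<close> turn \<open>p\<close>, \<open>q\<close>,
  \<open>r\<close> into 4, 4 and \<open>s - 2\<close>. Equality in both shifts leaves two of the
  three numbers equal to 4.\<close>

lemma reciprocal_sum3_le:
  fixes p q r s :: real
  assumes "p \<ge> 4" "q \<ge> 4" "r \<ge> 4" and s: "p + q + r = s + 6"
  shows "1 / p + 1 / q + 1 / r \<le> 1 / 2 + 1 / (s - 2)"
    and "1 / p + 1 / q + 1 / r = 1 / 2 + 1 / (s - 2) \<Longrightarrow>
      p = 4 \<and> q = 4 \<or> p = 4 \<and> r = 4 \<or> q = 4 \<and> r = 4"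
proof -
  have s': "p + q - 4 + r - 4 = s - 2" using s by simp
  have 1: "1 / p + 1 / q \<le> 1 / 4 + 1 / (p + q - 4)"
    and 2: "1 / (p + q - 4) + 1 / r \<le> 1 / 4 + 1 / (s - 2)"
    using reciprocal_sum_le(1)[of p q] reciprocal_sum_le(1)[of "p + q - 4" r] assms
    unfolding s' by auto
  show "1 / p + 1 / q + 1 / r \<le> 1 / 2 + 1 / (s - 2)" using 1 2 by linarith
  assume "1 / p + 1 / q + 1 / r = 1 / 2 + 1 / (s - 2)"
  then have "1 / p + 1 / q = 1 / 4 + 1 / (p + q - 4)"
    "1 / (p + q - 4) + 1 / r = 1 / 4 + 1 / (s - 2)"
    using 1 2 by linarith+
  then have "p = 4 \<or> q = 4" "p + q - 4 = 4 \<or> r = 4"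
    using reciprocal_sum_le(2)[of p q] reciprocal_sum_le(2)[of "p + q - 4" r] assms
    unfolding s' by auto
  then show "p = 4 \<and> q = 4 \<or> p = 4 \<and> r = 4 \<or> q = 4 \<and> r = 4" using assms by auto
qed

section \<open>Extremal graphs\<close>

locale graph =
  fixes V :: "'a set" and E :: "'a \<Rightarrow> 'a \<Rightarrow> bool"
  assumes finite_V [simp]: "finite V"
    and E_sym: "E x y \<Longrightarrow> E y x"
    and E_irrefl [simp]: "\<not> E x x"
    and E_V: "E x y \<Longrightarrow> x \<in> V"
begin

definition clique :: "'a set \<Rightarrow> bool" where
  "clique \<sigma> \<longleftrightarrow> \<sigma> \<subseteq> V \<and> (\<forall>x\<in>\<sigma>. \<forall>y\<in>\<sigma>. x \<noteq> y \<longrightarrow> E x y)"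

text \<open>For the graph of a pure flag complex of dimension 3 these are the facets that contain
  \<open>S\<close>.\<close>

definition K4 :: "'a set \<Rightarrow> 'a set set" where
  "K4 S = {\<sigma>. clique \<sigma> \<and> card \<sigma> = 4 \<and> S \<subseteq> \<sigma>}"

text \<open>For a face \<open>S\<close> of a flag complex this is the vertex set of the link of
  \<open>S\<close>; in particular \<open>nbrs {}\<close> is \<open>V\<close>.\<close>

definition nbrs :: "'a set \<Rightarrow> 'a set" where
  "nbrs S = {w \<in> V. \<forall>x\<in>S. E x w}"

abbreviation deg :: "'a \<Rightarrow> nat" where "deg v \<equiv> card (nbrs {v})"

text \<open>On an edge this is the degree of \<open>y\<close> in the link of \<open>x\<close>, and
  also the number of vertices in the link of the edge.\<close>

abbreviation codeg :: "'a \<Rightarrow> 'a \<Rightarrow> nat" where "codeg x y \<equiv> card (nbrs {x, y})"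

lemma E_V2: "E x y \<Longrightarrow> y \<in> V"
  by (rule E_V[OF E_sym])

lemma nbrs_sym: "nbrs S = {w \<in> V. \<forall>x\<in>S. E w x}"
  by (subst nbrs_def) (metis E_sym)

lemma finite_nbrs [simp]: "finite (nbrs S)" by (simp add: nbrs_def)

lemma nbrs_disjoint: "nbrs S \<inter> S = {}" by (auto simp: nbrs_def)

lemma cliqueD: "clique \<sigma> \<Longrightarrow> x \<in> \<sigma> \<Longrightarrow> y \<in> \<sigma> \<Longrightarrow> x \<noteq> y \<Longrightarrow> E x y"
  unfolding clique_def by blast

lemma clique_subset: "clique \<sigma> \<Longrightarrow> \<tau> \<subseteq> \<sigma> \<Longrightarrow> clique \<tau>"
  unfolding clique_def by blast

lemma clique_insert: "clique (insert x \<sigma>) \<longleftrightarrow> clique \<sigma> \<and> x \<in> V \<and> (x \<in> \<sigma> \<or> x \<in> nbrs \<sigma>)"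
  unfolding clique_def nbrs_def by (auto intro: E_sym)

lemma clique_empty [simp]: "clique {}" by (simp add: clique_def)

lemma finite_clique: "clique \<sigma> \<Longrightarrow> finite \<sigma>"
  unfolding clique_def using finite_V finite_subset by blast

lemma finite_K4 [simp]: "finite (K4 S)"
  by (rule finite_subset[of _ "Pow V"]) (auto simp: K4_def clique_def)

lemma K4_D: "\<sigma> \<in> K4 S \<Longrightarrow> clique \<sigma> \<and> card \<sigma> = 4 \<and> S \<subseteq> \<sigma> \<and> finite \<sigma> \<and> \<sigma> \<subseteq> V"
  using finite_clique by (auto simp: K4_def clique_def)

lemma K4_mono: "\<sigma> \<in> K4 S \<Longrightarrow> S' \<subseteq> \<sigma> \<Longrightarrow> \<sigma> \<in> K4 S'"
  by (auto simp: K4_def)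

text \<open>Counts in two ways the pairs of a 4-clique over \<open>S\<close> and a vertex of it
  outside \<open>S\<close>. The weight \<open>h\<close> is 1 for counting facets, the degree for the
  second moment, and a reciprocal codegree in \<open>codeg_eq4\<close>, hence the general
  semiring.\<close>

lemma double_count:
  fixes h :: "'a \<Rightarrow> 'b::comm_semiring_1"
  shows "(\<Sum>\<sigma>\<in>K4 S. \<Sum>x\<in>\<sigma> - S. h x) = (\<Sum>x\<in>nbrs S. of_nat (card (K4 (insert x S))) * h x)"
proof -
  have "\<sigma> - S = {x \<in> nbrs S. x \<in> \<sigma>}" if "\<sigma> \<in> K4 S" for \<sigma>
  proof -
    have "x \<in> nbrs S" if "x \<in> \<sigma>" "x \<notin> S" for x
      using that \<open>\<sigma> \<in> K4 S\<close> unfolding K4_def clique_def nbrs_def by fast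
    then show ?thesis using nbrs_disjoint[of S] by fast
  qed
  then have "(\<Sum>\<sigma>\<in>K4 S. \<Sum>x\<in>\<sigma> - S. h x) = (\<Sum>\<sigma>\<in>K4 S. \<Sum>x | x \<in> nbrs S \<and> x \<in> \<sigma>. h x)"
    by (intro sum.cong) auto
  also have "\<dots> = (\<Sum>x\<in>nbrs S. \<Sum>\<sigma> | \<sigma> \<in> K4 S \<and> x \<in> \<sigma>. h x)"
    by (rule sum.swap_restrict) auto
  also have "\<dots> = (\<Sum>x\<in>nbrs S. of_nat (card (K4 (insert x S))) * h x)"
  proof (rule sum.cong)
    fix x
    have "{\<sigma> \<in> K4 S. x \<in> \<sigma>} = K4 (insert x S)" by (auto simp: K4_def)
    then show "(\<Sum>\<sigma> | \<sigma> \<in> K4 S \<and> x \<in> \<sigma>. h x) = of_nat (card (K4 (insert x S))) * h x"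
      by simp
  qed simp
  finally show ?thesis .
qed

lemma sum_adjacent_swap:
  assumes "finite A" "finite U"
  shows "(\<Sum>v\<in>A. card {w \<in> U. E v w}) = (\<Sum>w\<in>U. card {v \<in> A. E w v})"
proof -
  have "{v \<in> A. E v w} = {v \<in> A. E w v}" for w by (auto intro: E_sym)
  then show ?thesis using sum.swap_restrict[OF assms, of "\<lambda>_ _. 1::nat" E] by simp
qed

end

section \<open>Facets and degrees under the local Eulerian conditions\<close>

text \<open>What the counting takes from the complex: dimension at most 3, purity, links of
  triangles with two vertices, and the number of triangles in the link of a vertex. The last one is
  stated additively to avoid truncated subtraction.\<close>

locale eulerian_graph = graph +
  assumes card_clique_le: "clique \<sigma> \<Longrightarrow> card \<sigma> \<le> 4"
    and clique_extend: "clique \<sigma> \<Longrightarrow> K4 \<sigma> \<noteq> {}"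
    and card_nbrs_triangle: "clique \<tau> \<Longrightarrow> card \<tau> = 3 \<Longrightarrow> card (nbrs \<tau>) = 2"
    and card_K4_vertex: "v \<in> V \<Longrightarrow> card (K4 {v}) + 4 = 2 * deg v"
begin

lemma no_K5: "clique \<sigma> \<Longrightarrow> card \<sigma> = 4 \<Longrightarrow> nbrs \<sigma> = {}"
proof (rule ccontr)
  assume \<sigma>: "clique \<sigma>" "card \<sigma> = 4" "nbrs \<sigma> \<noteq> {}"
  then obtain w where w: "w \<in> nbrs \<sigma>" by blast
  then have "w \<in> V" by (simp add: nbrs_def)
  then have "clique (insert w \<sigma>)" using \<sigma>(1) w unfolding clique_insert by blast
  moreover have "card (insert w \<sigma>) = 5"
  proof -
    have "w \<notin> \<sigma>" using w nbrs_disjoint[of \<sigma>] by blast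
    then show ?thesis using \<sigma>(2) finite_clique[OF \<sigma>(1)] by simp
  qed
  ultimately show False using card_clique_le[of "insert w \<sigma>"] by linarith
qed

text \<open>Each of the two common neighbours of the triangle completes it to exactly one
  facet.\<close>

lemma card_K4_triangle:
  assumes "clique \<tau>" "card \<tau> = 3"
  shows "card (K4 \<tau>) = 2"
proof -
  have fin: "finite \<tau>" using assms finite_clique by blast
  have one: "K4 (insert x \<tau>) = {insert x \<tau>}" if "x \<in> nbrs \<tau>" for x
  proof -
    have x: "x \<notin> \<tau>" using that nbrs_disjoint[of \<tau>] by auto
    then have "card (insert x \<tau>) = 4" using assms fin by simp
    moreover have "clique (insert x \<tau>)" using that assms by (auto simp: clique_insert nbrs_def)
    moreover have "\<sigma> = insert x \<tau>" if "\<sigma> \<in> K4 (insert x \<tau>)" for \<sigma>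
      using K4_D[OF that] \<open>card (insert x \<tau>) = 4\<close> card_subset_eq[of \<sigma> "insert x \<tau>"] by auto
    ultimately show ?thesis unfolding K4_def by blast
  qed
  have "(\<Sum>\<sigma>\<in>K4 \<tau>. \<Sum>x\<in>\<sigma> - \<tau>. 1::nat) = (\<Sum>\<sigma>\<in>K4 \<tau>. 1)"
    using assms fin by (intro sum.cong) (auto dest!: K4_D simp: card_Diff_subset)
  then show ?thesis
    using double_count[where S = \<tau> and h = "\<lambda>_. 1::nat"] one card_nbrs_triangle[OF assms] by simp
qed

text \<open>The link of the edge has as many edges as vertices: each facet on the edge has two
  further vertices, and each triangle on it lies in two facets.\<close>

lemma card_K4_edge:
  assumes "E a x"
  shows "card (K4 {a, x}) = codeg a x"
proof -
  have ne: "a \<noteq> x" and V: "a \<in> V" "x \<in> V" using assms E_V E_V2 by auto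
  have tri: "card (K4 (insert y {a, x})) = 2" if "y \<in> nbrs {a, x}" for y
    using that ne V assms nbrs_disjoint[of "{a, x}"]
    by (intro card_K4_triangle) (auto simp: clique_def nbrs_def card_insert_if intro: E_sym)
  have "(\<Sum>\<sigma>\<in>K4 {a, x}. \<Sum>x\<in>\<sigma> - {a, x}. 1::nat) = (\<Sum>\<sigma>\<in>K4 {a, x}. 2)"
    using ne by (intro sum.cong) (auto dest!: K4_D simp: card_Diff_subset)
  then show ?thesis
    using double_count[where S = "{a, x}" and h = "\<lambda>_. 1::nat"] tri by simp
qed

text \<open>The set is \<open>nbrs {a, b, y}\<close>, the two vertices that complete a triangle.
  Thus the link of an edge is a 2-regular graph.\<close>

lemma regular_edge_nbrs:
  assumes "E a b" "y \<in> nbrs {a, b}"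
  shows "card {z \<in> nbrs {a, b}. E y z} = 2"
proof -
  have "{z \<in> nbrs {a, b}. E y z} = nbrs {a, b, y}" by (auto simp: nbrs_def)
  moreover have "card (nbrs {a, b, y}) = 2"
    using assms E_V E_V2
    by (intro card_nbrs_triangle) (auto simp: clique_def nbrs_def card_insert_if intro: E_sym)
  ultimately show ?thesis by simp
qed

lemma K4_I:
  assumes "E a b" "E a c" "E a d" "E b c" "E b d" "E c d"
  shows "{a, b, c, d} \<in> K4 {}"
proof -
  have "a \<noteq> b" "a \<noteq> c" "a \<noteq> d" "b \<noteq> c" "b \<noteq> d" "c \<noteq> d" using assms by auto
  then have "card {a, b, c, d} = 4" by simp
  moreover have "clique {a, b, c, d}"
    using assms assms[THEN E_sym] assms[THEN E_V] assms(6)[THEN E_V2] by (simp add: clique_def)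
  ultimately show ?thesis by (simp add: K4_def)
qed

lemma edge_nbrs_edge:
  assumes "E a b" "y \<in> nbrs {a, b}"
  obtains z where "z \<in> nbrs {a, b}" "E y z" "{a, b, y, z} \<in> K4 {}"
proof -
  obtain z where z: "z \<in> nbrs {a, b}" "E y z"
    using regular_edge_nbrs[OF assms] by (metis (mono_tags, lifting) Collect_empty_eq card.empty zero_neq_numeral)
  have "{a, b, y, z} \<in> K4 {}"
    using assms z by (intro K4_I) (auto simp: nbrs_def)
  then show ?thesis using z that by blast
qed

text \<open>In the link of the edge, an edge \<open>cd\<close> has a further neighbour at each end,
  and these two differ because there is no 5-clique.\<close>

lemma codeg_ge4:
  assumes "E a b"
  shows "codeg a b \<ge> 4"
proof -
  have "clique {a, b}"
    using assms assms[THEN E_sym] assms[THEN E_V] assms[THEN E_V2] by (simp add: clique_def)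
  then obtain \<sigma> where "\<sigma> \<in> K4 {a, b}" using clique_extend by blast
  then have \<sigma>: "clique \<sigma>" "card \<sigma> = 4" "{a, b} \<subseteq> \<sigma>" "finite \<sigma>" by (auto dest: K4_D)
  have "a \<noteq> b" using assms by auto
  then have "card (\<sigma> - {a, b}) = 2" using \<sigma> by (simp add: card_Diff_subset)
  then obtain c d where cd: "\<sigma> - {a, b} = {c, d}" "c \<noteq> d" by (meson card_2_iff)
  then have "{a, b, c, d} = \<sigma>" using \<sigma> by auto
  then have cl: "clique {a, b, c, d}" "card {a, b, c, d} = 4" using \<sigma> by auto
  have dist: "c \<noteq> a" "c \<noteq> b" "d \<noteq> a" "d \<noteq> b" using cd by auto
  have inM: "c \<in> nbrs {a, b}" "d \<in> nbrs {a, b}" and cd': "E c d"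
    using cl(1) dist dist[symmetric] cd(2) by (simp_all add: clique_def nbrs_def)
  have "\<exists>d'. d' \<in> nbrs {a, b} \<and> E c d' \<and> d' \<noteq> d"
  proof (rule ccontr)
    assume "\<not> ?thesis"
    then have "{z \<in> nbrs {a, b}. E c z} \<subseteq> {d}" by auto
    then have "card {z \<in> nbrs {a, b}. E c z} \<le> card {d}" by (intro card_mono) auto
    then show False using regular_edge_nbrs[OF assms inM(1)] by simp
  qed
  then obtain d' where d': "d' \<in> nbrs {a, b}" "E c d'" "d' \<noteq> d" by blast
  have "\<exists>c'. c' \<in> nbrs {a, b} \<and> E d c' \<and> c' \<noteq> c"
  proof (rule ccontr)
    assume "\<not> ?thesis"
    then have "{z \<in> nbrs {a, b}. E d z} \<subseteq> {c}" by auto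
    then have "card {z \<in> nbrs {a, b}. E d z} \<le> card {c}" by (intro card_mono) auto
    then show False using regular_edge_nbrs[OF assms inM(2)] by simp
  qed
  then obtain c' where c': "c' \<in> nbrs {a, b}" "E d c'" "c' \<noteq> c" by blast
  have "c' \<noteq> d'"
  proof
    assume "c' = d'"
    then have "c' \<in> nbrs {a, b, c, d}" using c' d' by (simp add: nbrs_def)
    then show False using no_K5[OF cl] by simp
  qed
  moreover have "c' \<noteq> d" "d' \<noteq> c" using c'(2) d'(2) by auto
  ultimately have "card {c, d, c', d'} = 4" using c'(3) d'(3) cd(2) by (auto simp: card_insert_if)
  moreover have "{c, d, c', d'} \<subseteq> nbrs {a, b}" using c' d' inM by auto
  ultimately show ?thesis by (metis card_mono finite_nbrs)
qed

text \<open>Each vertex of \<open>\<sigma>\<close> is the only non-neighbour in \<open>\<sigma>\<close> of exactly one vertex outside.\<close>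

lemma opposite_vertices:
  assumes "\<sigma> \<in> K4 {}"
  obtains X where "X \<subseteq> V - \<sigma>" "card X = 4" "\<forall>a\<in>\<sigma>. card (X \<inter> nbrs {a}) = 3"
    "\<forall>w\<in>X. card {x \<in> \<sigma>. E w x} = 3"
    "\<forall>w\<in>V - \<sigma> - X. card {x \<in> \<sigma>. E w x} \<le> 2"
proof -
  have \<sigma>: "clique \<sigma>" "card \<sigma> = 4" "finite \<sigma>" "\<sigma> \<subseteq> V" using K4_D[OF assms] by auto
  have "\<exists>w. nbrs (\<sigma> - {v}) = {v, w} \<and> v \<noteq> w" if "v \<in> \<sigma>" for v
  proof -
    have "card (nbrs (\<sigma> - {v})) = 2"
      using \<sigma> that clique_subset[OF \<sigma>(1), of "\<sigma> - {v}"] by (intro card_nbrs_triangle) auto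
    moreover have "v \<in> nbrs (\<sigma> - {v})" using \<sigma>(1,4) that by (auto simp: clique_def nbrs_def)
    ultimately show ?thesis unfolding card_2_iff by fastforce
  qed
  then have "\<forall>v\<in>\<sigma>. \<exists>w. nbrs (\<sigma> - {v}) = {v, w} \<and> v \<noteq> w" by blast
  \<comment> \<open>\<open>f v\<close> is the vertex opposite to \<open>v\<close>: the second vertex
    that completes the triangle \<open>\<sigma> - {v}\<close> to a facet.\<close>
  then obtain f where "\<forall>v\<in>\<sigma>. nbrs (\<sigma> - {v}) = {v, f v} \<and> v \<noteq> f v" unfolding bchoice_iff ..
  then have f: "\<And>v. v \<in> \<sigma> \<Longrightarrow> nbrs (\<sigma> - {v}) = {v, f v} \<and> v \<noteq> f v" by blast
  have adj: "E w x" if "w \<in> nbrs (\<sigma> - {v})" "x \<in> \<sigma>" "x \<noteq> v" for v w x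
    using that by (simp add: nbrs_sym)
  have out: "f v \<in> V - \<sigma>" "\<not> E (f v) v" if v: "v \<in> \<sigma>" for v
  proof -
    have fv: "f v \<in> nbrs (\<sigma> - {v})" using f[OF v] by auto
    then have "f v \<notin> \<sigma> - {v}" using nbrs_disjoint by blast
    then show o: "f v \<in> V - \<sigma>" using fv f[OF v] by (metis (no_types, lifting) DiffI empty_iff insert_iff mem_Collect_eq nbrs_def)
    show "\<not> E (f v) v"
    proof
      assume "E (f v) v"
      then have "f v \<in> nbrs \<sigma>" using fv by (auto simp: nbrs_sym)
      then show False using no_K5[OF \<sigma>(1,2)] by simp
    qed
  qed
  have iff: "E (f v) x \<longleftrightarrow> x \<noteq> v" if "v \<in> \<sigma>" "x \<in> \<sigma>" for v x
  proof (cases "x = v")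
    case True
    then show ?thesis using out(2)[OF that(1)] by simp
  next
    case False
    have "f v \<in> nbrs (\<sigma> - {v})" using f[OF that(1)] by blast
    then show ?thesis using adj[OF _ that(2) False] False by blast
  qed
  \<comment> \<open>The only non-neighbour of \<open>f v\<close> in \<open>\<sigma>\<close> is
    \<open>v\<close>, so \<open>f v\<close> determines \<open>v\<close>.\<close>
  have inj: "inj_on f \<sigma>"
  proof (rule inj_onI)
    fix v w assume v: "v \<in> \<sigma>" and w: "w \<in> \<sigma>" and eq: "f v = f w"
    have "\<not> E (f v) w" unfolding eq using iff[OF w w] by blast
    then show "v = w" using iff[OF v w] by blast
  qed
  define X where "X = f ` \<sigma>"
  show ?thesis
  proof
    show "X \<subseteq> V - \<sigma>" using out(1) unfolding X_def by blast
    show "card X = 4" using card_image[OF inj] \<sigma> by (simp add: X_def)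
    show "\<forall>a\<in>\<sigma>. card (X \<inter> nbrs {a}) = 3"
    proof
      fix a assume a: "a \<in> \<sigma>"
      have "X \<inter> nbrs {a} = f ` (\<sigma> - {a})"
      proof (intro set_eqI iffI)
        fix w assume "w \<in> X \<inter> nbrs {a}"
        then obtain v where v: "v \<in> \<sigma>" "w = f v" "E w a" by (auto simp: X_def nbrs_sym)
        then have "v \<noteq> a" using iff[OF v(1) a] by simp
        then show "w \<in> f ` (\<sigma> - {a})" using v by simp
      next
        fix w assume "w \<in> f ` (\<sigma> - {a})"
        then obtain v where v: "v \<in> \<sigma>" "w = f v" "a \<noteq> v" by blast
        then show "w \<in> X \<inter> nbrs {a}"
          using iff[OF v(1) a] out(1)[OF v(1)] by (simp add: X_def nbrs_sym)
      qed
      moreover have "card (f ` (\<sigma> - {a})) = card (\<sigma> - {a})"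
        by (intro card_image inj_on_subset[OF inj]) auto
      ultimately show "card (X \<inter> nbrs {a}) = 3" using \<sigma> a by simp
    qed
    show "\<forall>w\<in>X. card {x \<in> \<sigma>. E w x} = 3"
    proof
      fix w assume "w \<in> X"
      then obtain v where v: "v \<in> \<sigma>" "w = f v" by (auto simp: X_def)
      then have "{x \<in> \<sigma>. E w x} = \<sigma> - {v}" using iff[OF v(1)] by blast
      then show "card {x \<in> \<sigma>. E w x} = 3" using v \<sigma> by simp
    qed
    \<comment> \<open>A vertex outside \<open>\<sigma>\<close> with at least three neighbours in it
      misses exactly one \<open>v\<close>, as there is no 5-clique. It then completes
      \<open>\<sigma> - {v}\<close>, so it is \<open>v\<close> or \<open>f v\<close>.\<close>
    show "\<forall>w\<in>V - \<sigma> - X. card {x \<in> \<sigma>. E w x} \<le> 2"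
    proof (intro ballI, rule ccontr)
      fix w assume w: "w \<in> V - \<sigma> - X" and c: "\<not> card {x \<in> \<sigma>. E w x} \<le> 2"
      let ?A = "{x \<in> \<sigma>. E w x}"
      have A: "?A \<subseteq> \<sigma>" by auto
      have "?A \<noteq> \<sigma>"
      proof
        assume "?A = \<sigma>"
        then show False
          using no_K5[OF \<sigma>(1,2)] w unfolding nbrs_sym by blast
      qed
      then obtain v where v: "v \<in> \<sigma>" "\<not> E w v" by auto
      have "?A \<subseteq> \<sigma> - {v}" using v by auto
      moreover have "card (\<sigma> - {v}) \<le> card ?A" using c v \<sigma> by simp
      ultimately have "?A = \<sigma> - {v}" using \<sigma>(3) by (simp add: card_seteq)
      then have "w \<in> nbrs (\<sigma> - {v})" using w unfolding nbrs_sym by blast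
      then have "w = v \<or> w = f v" using f[OF v(1)] by blast
      then show False using w v(1) unfolding X_def by blast
    qed
  qed
qed

text \<open>A facet comes with four opposite vertices outside it.\<close>

lemma card_V_ge8: "card V \<ge> 8"
proof -
  obtain \<sigma> where \<sigma>: "\<sigma> \<in> K4 {}" using clique_extend[of "{}"] by auto
  obtain X where "X \<subseteq> V - \<sigma>" "card X = 4" by (rule opposite_vertices[OF \<sigma>])
  then have "4 \<le> card (V - \<sigma>)" by (metis card_mono finite_Diff finite_V)
  then show ?thesis using K4_D[OF \<sigma>] card_mono[of V \<sigma>] by (simp add: card_Diff_subset)
qed

lemma nbrs1: "nbrs {v} = {w \<in> V. E v w}" by (simp add: nbrs_def)

text \<open>Pairs of a vertex of \<open>\<sigma>\<close> and a neighbour of it are counted at the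
  neighbour: 3 for each of the four vertices of \<open>\<sigma>\<close> and of the four opposite
  vertices, at most 2 for each of the other \<open>card V - 8\<close>. For the second part the count
  is restricted to the neighbours of \<open>a\<close>.\<close>

lemma sum_deg_le:
  assumes "\<sigma> \<in> K4 {}"
  shows "(\<Sum>v\<in>\<sigma>. deg v) \<le> 2 * card V + 8"
    and "(\<Sum>v\<in>\<sigma>. deg v) = 2 * card V + 8 \<Longrightarrow> a \<in> \<sigma> \<Longrightarrow>
      (\<Sum>x\<in>\<sigma> - {a}. codeg a x) = deg a + 6"
proof -
  have \<sigma>: "clique \<sigma>" "card \<sigma> = 4" "finite \<sigma>" "\<sigma> \<subseteq> V" using K4_D[OF assms] by auto
  obtain X where X: "X \<subseteq> V - \<sigma>" "card X = 4" "\<forall>a\<in>\<sigma>. card (X \<inter> nbrs {a}) = 3"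
    "\<forall>w\<in>X. card {x \<in> \<sigma>. E w x} = 3"
    "\<forall>w\<in>V - \<sigma> - X. card {x \<in> \<sigma>. E w x} \<le> 2"
    by (rule opposite_vertices[OF assms])
  have finX: "finite X" using X(1) finite_subset by fastforce
  define g where "g w = card {x \<in> \<sigma>. E w x}" for w
  define R where "R = V - \<sigma> - X"
  have inside: "{x \<in> \<sigma>. E w x} = \<sigma> - {w}" if "w \<in> \<sigma>" for w
    using that E_irrefl by (blast intro: cliqueD[OF \<sigma>(1)])
  have cardR: "card R + 8 = card V"
  proof -
    have "card (V - \<sigma>) + 4 = card V"
      using \<sigma> card_mono[of V \<sigma>] by (simp add: card_Diff_subset)
    moreover have "card R + 4 = card (V - \<sigma>)"
      unfolding R_def using X(1,2) finX card_mono[OF _ X(1)] by (simp add: card_Diff_subset)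
    ultimately show ?thesis by simp
  qed
  have split: "V = \<sigma> \<union> X \<union> R" "\<sigma> \<inter> X = {}" "(\<sigma> \<union> X) \<inter> R = {}" "finite R"
    using \<sigma> X(1) by (auto simp: R_def)
  have "(\<Sum>v\<in>\<sigma>. deg v) = (\<Sum>w\<in>V. g w)"
    unfolding nbrs1 g_def using \<sigma> by (intro sum_adjacent_swap) auto
  also have "\<dots> = (\<Sum>w\<in>\<sigma>. g w) + (\<Sum>w\<in>X. g w) + (\<Sum>w\<in>R. g w)"
    using split \<sigma>(3) finX by (simp add: sum.union_disjoint)
  also have "(\<Sum>w\<in>\<sigma>. g w) = (\<Sum>w\<in>\<sigma>. 3)"
    using \<sigma> by (intro sum.cong) (auto simp: g_def inside)
  also have "(\<Sum>w\<in>X. g w) = (\<Sum>w\<in>X. 3)"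
    using X by (intro sum.cong) (auto simp: g_def)
  finally have eq: "(\<Sum>v\<in>\<sigma>. deg v) = 24 + (\<Sum>w\<in>R. g w)" using \<sigma> X by simp
  have gR: "g w \<le> 2" if "w \<in> R" for w using X(5) that by (auto simp: R_def g_def)
  then have le: "(\<Sum>w\<in>R. g w) \<le> (\<Sum>w\<in>R. 2)" by (intro sum_mono)
  then show "(\<Sum>v\<in>\<sigma>. deg v) \<le> 2 * card V + 8" using eq cardR by simp
  assume max: "(\<Sum>v\<in>\<sigma>. deg v) = 2 * card V + 8" and a: "a \<in> \<sigma>"
  have "(\<Sum>w\<in>R. g w) = (\<Sum>w\<in>R. 2)" using eq max cardR by simp
  then have gR2: "g w = 2" if "w \<in> R" for w
    using sum_mono_inv[of g R "\<lambda>_. 2"] gR split(4) that by auto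
  have aV: "a \<in> V" using a \<sigma> by auto
  \<comment> \<open>One of the \<open>g w\<close> neighbours of \<open>w\<close> in
    \<open>\<sigma>\<close> is \<open>a\<close> itself.\<close>
  have less: "card {x \<in> \<sigma> - {a}. E w x} + 1 = g w" if "w \<in> nbrs {a}" for w
  proof -
    have "{x \<in> \<sigma>. E w x} = insert a {x \<in> \<sigma> - {a}. E w x}"
      using that a by (auto simp: nbrs_sym)
    then show ?thesis unfolding g_def using \<sigma>(3) by (metis (no_types, lifting) DiffE Suc_eq_plus1 card_insert_disjoint finite_Diff finite_subset insertCI mem_Collect_eq subsetI)
  qed
  \<comment> \<open>The neighbours of \<open>a\<close> are three vertices of
    \<open>\<sigma>\<close>, three opposite vertices and \<open>deg a - 6\<close> others. They
    contribute 2, 2 and 1 each to the sum of codegrees, in total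
    \<open>12 + (deg a - 6)\<close>.\<close>
  have na: "nbrs {a} = (\<sigma> - {a}) \<union> (X \<inter> nbrs {a}) \<union> (R \<inter> nbrs {a})"
  proof -
    have "nbrs {a} \<subseteq> V" "a \<notin> nbrs {a}" by (auto simp: nbrs_def)
    moreover have "\<sigma> - {a} \<subseteq> nbrs {a}"
      using cliqueD[OF \<sigma>(1) a] \<sigma>(4) unfolding nbrs_def by blast
    ultimately show ?thesis using split(1) by blast
  qed
  have disj: "(\<sigma> - {a}) \<inter> (X \<inter> nbrs {a}) = {}"
    "((\<sigma> - {a}) \<union> (X \<inter> nbrs {a})) \<inter> (R \<inter> nbrs {a}) = {}" using split by auto
  have fins: "finite (\<sigma> - {a})" "finite (X \<inter> nbrs {a})" "finite (R \<inter> nbrs {a})"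
    using \<sigma> finX split by auto
  have "deg a = card (\<sigma> - {a}) + card (X \<inter> nbrs {a}) + card (R \<inter> nbrs {a})"
    by (subst na) (use disj fins in \<open>simp add: card_Un_disjoint\<close>)
  then have da: "deg a = 6 + card (R \<inter> nbrs {a})" using a \<sigma> X(3)[rule_format, OF a] by simp
  have "(\<Sum>x\<in>\<sigma> - {a}. codeg a x) = (\<Sum>x\<in>\<sigma> - {a}. card {w \<in> nbrs {a}. E x w})"
    by (intro sum.cong arg_cong[where f = card]) (auto simp: nbrs_def)
  also have "\<dots> = (\<Sum>w\<in>nbrs {a}. card {x \<in> \<sigma> - {a}. E w x})"
    using \<sigma> by (intro sum_adjacent_swap) auto
  also have "\<dots> = (\<Sum>w\<in>nbrs {a}. g w - 1)"
    using less by (intro sum.cong) (auto simp: less[symmetric])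
  also have "\<dots> = (\<Sum>w\<in>\<sigma> - {a}. g w - 1) + (\<Sum>w\<in>X \<inter> nbrs {a}. g w - 1)
      + (\<Sum>w\<in>R \<inter> nbrs {a}. g w - 1)"
    by (subst na) (use disj fins in \<open>simp add: sum.union_disjoint\<close>)
  also have "(\<Sum>w\<in>\<sigma> - {a}. g w - 1) = (\<Sum>w\<in>\<sigma> - {a}. 2)"
    using \<sigma> by (intro sum.cong) (auto simp: g_def inside)
  also have "(\<Sum>w\<in>X \<inter> nbrs {a}. g w - 1) = (\<Sum>w\<in>X \<inter> nbrs {a}. 2)"
    using X by (intro sum.cong) (auto simp: g_def)
  also have "(\<Sum>w\<in>R \<inter> nbrs {a}. g w - 1) = (\<Sum>w\<in>R \<inter> nbrs {a}. 1)"
    using gR2 by (intro sum.cong) auto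
  finally show "(\<Sum>x\<in>\<sigma> - {a}. codeg a x) = deg a + 6"
    using da a \<sigma> X(3)[rule_format, OF a] by simp
qed

end

section \<open>The equality case and the join structure\<close>

text \<open>By the handshake count, the added assumption prescribes the number of edges of
  \<open>J2 (card V)\<close>.\<close>

locale extremal_graph = eulerian_graph +
  assumes sum_deg: "(\<Sum>v\<in>V. deg v) = 2 * ((card V div 2) * ((card V + 1) div 2) + card V)"
begin

text \<open>Summed over all facets, the degree sums are expressed by the first two moments of the
  degrees. A lower bound on the second moment makes their average at least
  \<open>2 * card V + 8\<close>, which is the upper bound for each of them in
  \<open>sum_deg_le\<close>.\<close>

lemma sum_deg_K4:
  assumes "\<sigma> \<in> K4 {}"
  shows "(\<Sum>v\<in>\<sigma>. deg v) = 2 * card V + 8"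
proof -
  define h where "h = int (card V div 2)"
  define p where "p = int ((card V + 1) div 2)"
  define N where "N = int (card V)"
  \<comment> \<open>In \<open>J2 (card V)\<close> the degrees are \<open>h + 2\<close> and
    \<open>p + 2\<close>, so each is \<open>q\<close> or \<open>q + 1\<close>; a polynomial with
    these roots loses nothing there.\<close>
  define q where "q = h + 2"
  define d where "d v = int (deg v)" for v
  define k where "k = int (card (K4 {}))"
  define s1 where "s1 = (\<Sum>v\<in>V. d v)"
  define s2 where "s2 = (\<Sum>v\<in>V. d v * d v)"
  define A where "A = (2 * q + 1) * s1 - N * (q * (q + 1))"
  have N: "N = h + p" "p = h \<or> p = h + 1"
    unfolding N_def h_def p_def by linarith+
  have nbrs_empty: "nbrs {} = V" by (simp add: nbrs_def)
  have K: "int (card (K4 {v})) = 2 * d v - 4" if "v \<in> V" for v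
    using card_K4_vertex[OF that] by (simp add: d_def)
  have s1: "s1 = 2 * (h * p + N)"
    unfolding s1_def d_def h_def p_def N_def of_nat_sum[symmetric] sum_deg by simp
  have "(\<Sum>\<sigma>\<in>K4 {}. \<Sum>v\<in>\<sigma> - {}. 1 :: int) = (\<Sum>\<sigma>\<in>K4 {}. 4)"
    by (intro sum.cong) (auto dest!: K4_D)
  then have "4 * k = (\<Sum>v\<in>V. 2 * d v - 4)"
    using double_count[where S = "{}" and h = "\<lambda>_. 1::int"] K nbrs_empty by (simp add: k_def)
  also have "\<dots> = 2 * s1 - 4 * N"
    by (simp add: sum_subtractf s1_def N_def sum_distrib_left)
  finally have k: "k = h * p" using s1 by simp
  have "(\<Sum>\<sigma>\<in>K4 {}. \<Sum>v\<in>\<sigma>. d v) = (\<Sum>v\<in>V. (2 * d v - 4) * d v)"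
    using double_count[where S = "{}" and h = d] K nbrs_empty by simp
  also have "\<dots> = 2 * s2 - 4 * s1"
    by (simp add: s1_def s2_def sum_subtractf sum_distrib_left sum_distrib_right algebra_simps)
  finally have T: "(\<Sum>\<sigma>\<in>K4 {}. \<Sum>v\<in>\<sigma>. d v) = 2 * s2 - 4 * s1" .
  \<comment> \<open>No integer lies strictly between \<open>q\<close> and
    \<open>q + 1\<close>.\<close>
  have "0 \<le> (d v - q) * (d v - (q + 1))" for v
    by (cases "d v \<le> q") (auto intro: mult_nonpos_nonpos mult_nonneg_nonneg)
  then have "0 \<le> (\<Sum>v\<in>V. (d v - q) * (d v - (q + 1)))" by (intro sum_nonneg)
  also have "\<dots> = s2 - (2 * q + 1) * s1 + N * (q * (q + 1))"
    by (simp add: s1_def s2_def N_def sum_subtractf sum.distrib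
        sum_distrib_left sum_distrib_right algebra_simps)
  finally have "A \<le> s2" by (simp add: A_def)
  \<comment> \<open>The lower bound for the total is exactly \<open>k\<close> times the upper bound
    for one facet; the two parities of \<open>card V\<close> are checked separately.\<close>
  moreover have "2 * A - 4 * s1 = k * (2 * N + 8)"
    unfolding A_def using N(2) unfolding k s1 N(1) q_def by (elim disjE) (simp_all add: algebra_simps)
  ultimately have "(\<Sum>\<sigma>\<in>K4 {}. \<Sum>v\<in>\<sigma>. d v) \<ge> k * (2 * N + 8)" using T by linarith
  then have "(\<Sum>\<sigma>\<in>K4 {}. 2 * N + 8 - (\<Sum>v\<in>\<sigma>. d v)) \<le> 0"
    by (simp add: sum_subtractf k_def)
  moreover have nonneg: "0 \<le> 2 * N + 8 - (\<Sum>v\<in>\<tau>. d v)" if "\<tau> \<in> K4 {}" for \<tau>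
  proof -
    have "int (\<Sum>v\<in>\<tau>. deg v) \<le> int (2 * card V + 8)"
      using sum_deg_le(1)[OF that] by (simp only: of_nat_le_iff)
    then show ?thesis by (simp add: d_def N_def)
  qed
  ultimately have "(\<Sum>\<sigma>\<in>K4 {}. 2 * N + 8 - (\<Sum>v\<in>\<sigma>. d v)) = 0"
    by (intro antisym sum_nonneg) auto
  then have "2 * N + 8 - (\<Sum>v\<in>\<sigma>. d v) = 0"
    using sum_nonneg_eq_0_iff[of "K4 {}" "\<lambda>\<tau>. 2 * N + 8 - (\<Sum>v\<in>\<tau>. d v)"]
      nonneg assms by simp
  then have "int (\<Sum>v\<in>\<sigma>. deg v) = int (2 * card V + 8)" by (simp add: d_def N_def)
  then show ?thesis by (simp only: of_nat_eq_iff)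
qed

lemma sum_codeg_K4:
  assumes "\<sigma> \<in> K4 {}" "a \<in> \<sigma>"
  shows "(\<Sum>x\<in>\<sigma> - {a}. codeg a x) = deg a + 6"
  using sum_deg_le(2)[OF assms(1) sum_deg_K4[OF assms(1)] assms(2)] .

text \<open>The reciprocals of the codegrees at \<open>a\<close> are summed over all facets at
  \<open>a\<close>. Every neighbour contributes 1 in total, so the sum is \<open>deg a\<close>. This
  is the number of facets times the bound of \<open>reciprocal_sum3_le\<close>, so the bound is
  attained at every facet.\<close>

lemma codeg_eq4:
  assumes \<sigma>: "\<sigma> \<in> K4 {}" and a: "a \<in> \<sigma>"
  shows "\<exists>x\<in>\<sigma> - {a}. \<forall>y\<in>\<sigma> - {a, x}. codeg a y = 4"
proof -
  define d where "d = real (deg a)"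
  define f where "f \<tau> = (\<Sum>x\<in>\<tau> - {a}. 1 / real (codeg a x))" for \<tau>
  \<comment> \<open>The bound of \<open>reciprocal_sum3_le\<close> at \<open>s = d\<close>;
    multiplied by the \<open>2 * d - 4\<close> facets at \<open>a\<close> it gives
    \<open>d\<close>.\<close>
  define B where "B = 1 / 2 + 1 / (d - 2)"
  have split: "\<exists>x y z. \<tau> - {a} = {x, y, z} \<and> x \<noteq> y \<and> y \<noteq> z \<and> x \<noteq> z \<and>
      real (codeg a x) \<ge> 4 \<and> real (codeg a y) \<ge> 4 \<and> real (codeg a z) \<ge> 4 \<and>
      real (codeg a x) + real (codeg a y) + real (codeg a z) = d + 6 \<and>
      f \<tau> = 1 / real (codeg a x) + 1 / real (codeg a y) + 1 / real (codeg a z)"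
    if \<tau>: "\<tau> \<in> K4 {a}" for \<tau>
  proof -
    have 1: "clique \<tau>" "card \<tau> = 4" "a \<in> \<tau>" "finite \<tau>" using K4_D[OF \<tau>] by auto
    then have "card (\<tau> - {a}) = 3" by simp
    then obtain x y z where x: "\<tau> - {a} = {x, y, z}" "x \<noteq> y" "y \<noteq> z" "x \<noteq> z"
      unfolding card_3_iff by blast
    have "codeg a w \<ge> 4" if "w \<in> {x, y, z}" for w
    proof -
      have "w \<in> \<tau>" "a \<noteq> w" using that x(1) by blast+
      then show ?thesis by (intro codeg_ge4 cliqueD[OF 1(1,3)])
    qed
    then have "codeg a x \<ge> 4" "codeg a y \<ge> 4" "codeg a z \<ge> 4" by simp_all
    moreover have "codeg a x + codeg a y + codeg a z = deg a + 6"
      using sum_codeg_K4[OF K4_mono[OF \<tau>] 1(3)] x by simp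
    then have "real (codeg a x) + real (codeg a y) + real (codeg a z) = d + 6"
      unfolding d_def by linarith
    moreover have "f \<tau> = 1 / real (codeg a x) + 1 / real (codeg a y) + 1 / real (codeg a z)"
      unfolding f_def x(1) using x(2-4) by simp
    ultimately show ?thesis using x by (intro exI[of _ x] exI[of _ y] exI[of _ z]) simp
  qed
  have \<sigma>a: "\<sigma> \<in> K4 {a}" using K4_mono[OF \<sigma>] a by simp
  have aV: "a \<in> V" using K4_D[OF \<sigma>] a by blast
  \<comment> \<open>Three codegrees of at least 4 sum to \<open>d + 6\<close>; this keeps the
    denominator \<open>d - 2\<close> away from 0.\<close>
  have d6: "d \<ge> 6" using split[OF \<sigma>a] by force
  have f_le: "f \<tau> \<le> B" if "\<tau> \<in> K4 {a}" for \<tau>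
    using split[OF that] reciprocal_sum3_le(1) unfolding B_def by metis
  have "(\<Sum>\<tau>\<in>K4 {a}. f \<tau>) = (\<Sum>x\<in>nbrs {a}. real (card (K4 {x, a})) * (1 / real (codeg a x)))"
    unfolding f_def by (rule double_count)
  \<comment> \<open>The edge \<open>ax\<close> lies in \<open>codeg a x\<close> facets, so the
    reciprocals belonging to \<open>x\<close> add up to 1.\<close>
  also have "\<dots> = (\<Sum>x\<in>nbrs {a}. 1)"
  proof (rule sum.cong)
    fix x assume "x \<in> nbrs {a}"
    then have "E a x" by (simp add: nbrs_def)
    then have "card (K4 {x, a}) = codeg a x" "codeg a x \<ge> 4"
      using card_K4_edge[of a x] codeg_ge4[of a x] by (simp_all add: insert_commute)
    moreover from this have "nbrs {a, x} \<noteq> {}" by (metis card.empty not_numeral_le_zero)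
    ultimately show "real (card (K4 {x, a})) * (1 / real (codeg a x)) = 1" by simp
  qed simp
  finally have sum_f: "(\<Sum>\<tau>\<in>K4 {a}. f \<tau>) = d" by (simp add: d_def)
  have "real (card (K4 {a})) = 2 * d - 4" using card_K4_vertex[OF aV] unfolding d_def by linarith
  then have "(\<Sum>\<tau>\<in>K4 {a}. B - f \<tau>) = (2 * d - 4) * B - d"
    by (simp add: sum_subtractf sum_f)
  also have "\<dots> = 0" using d6 unfolding B_def by (simp add: field_simps)
  finally have "f \<sigma> = B"
    using sum_nonneg_eq_0_iff[of "K4 {a}" "\<lambda>\<tau>. B - f \<tau>"] f_le \<sigma>a by simp
  obtain x y z where x: "\<sigma> - {a} = {x, y, z}" "x \<noteq> y" "y \<noteq> z" "x \<noteq> z"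
    and ge: "real (codeg a x) \<ge> 4" "real (codeg a y) \<ge> 4" "real (codeg a z) \<ge> 4"
    and sum: "real (codeg a x) + real (codeg a y) + real (codeg a z) = d + 6"
    and fx: "f \<sigma> = 1 / real (codeg a x) + 1 / real (codeg a y) + 1 / real (codeg a z)"
    using split[OF \<sigma>a] by blast
  have "codeg a x = 4 \<and> codeg a y = 4 \<or> codeg a x = 4 \<and> codeg a z = 4 \<or>
      codeg a y = 4 \<and> codeg a z = 4"
    using reciprocal_sum3_le(2)[OF ge sum] \<open>f \<sigma> = B\<close> unfolding fx B_def by simp
  moreover have "\<sigma> - {a, w} = {x, y, z} - {w}" for w using x(1) by blast
  ultimately show ?thesis unfolding x(1) using x(2-4) by auto
qed

text \<open>Adding the codegree equations at the four vertices shows that twice the sum of the six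
  codegrees is \<open>2 * card V + 32\<close>. If \<open>codeg a b\<close> is not 4, then
  \<open>codeg_eq4\<close> at \<open>a\<close> and at \<open>b\<close> gives codegree 4 to the four
  edges other than \<open>ab\<close> and \<open>cd\<close>. With eight vertices all six codegrees
  are 4, since none is smaller.\<close>

lemma codeg_opposite:
  assumes E: "E a b" "E a c" "E a d" "E b c" "E b d" "E c d"
    and ab: "codeg a b \<noteq> 4 \<or> card V = 8"
  shows "codeg a b + codeg c d = card V"
proof -
  let ?\<sigma> = "{a, b, c, d}"
  have \<sigma>: "?\<sigma> \<in> K4 {}" using K4_I[OF E] .
  have ne: "a \<noteq> b" "a \<noteq> c" "a \<noteq> d" "b \<noteq> c" "b \<noteq> d" "c \<noteq> d" using E by auto
  note ne' = ne ne[symmetric]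
  have minus: "?\<sigma> - {a} = {b, c, d}" "?\<sigma> - {b} = {a, c, d}" "?\<sigma> - {c} = {a, b, d}"
    "?\<sigma> - {d} = {a, b, c}" using ne by auto
  have comm: "codeg x y = codeg y x" for x y by (simp add: insert_commute)
  have 1: "codeg a b + codeg a c + codeg a d = deg a + 6"
    using sum_codeg_K4[OF \<sigma>, of a] unfolding minus using ne by simp
  have 2: "codeg a b + codeg b c + codeg b d = deg b + 6"
    using sum_codeg_K4[OF \<sigma>, of b] comm[of b a] unfolding minus using ne by simp
  have 3: "codeg a c + codeg b c + codeg c d = deg c + 6"
    using sum_codeg_K4[OF \<sigma>, of c] comm[of c a] comm[of c b] unfolding minus using ne by simp
  have 4: "codeg a d + codeg b d + codeg c d = deg d + 6"
    using sum_codeg_K4[OF \<sigma>, of d] comm[of d a] comm[of d b] comm[of d c]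
    unfolding minus using ne by simp
  have sum: "deg a + deg b + deg c + deg d = 2 * card V + 8"
    using sum_deg_K4[OF \<sigma>] ne by simp
  note ge = E[THEN codeg_ge4]
  show ?thesis
  proof (cases "card V = 8")
    case True
    then show ?thesis using 1 2 3 4 sum ge by linarith
  next
    case False
    then have ab4: "codeg a b \<noteq> 4" using ab by blast
    have "codeg a c = 4" "codeg a d = 4"
      using codeg_eq4[OF \<sigma>, of a] ab4 ne' by auto
    moreover have "codeg b c = 4" "codeg b d = 4"
      using codeg_eq4[OF \<sigma>, of b] ab4 ne' unfolding comm[of a b] by auto
    ultimately show ?thesis using 1 2 3 4 sum by linarith
  qed
qed

text \<open>A common element would be adjacent to the whole facet, so the two sets are disjoint; by
  \<open>codeg_opposite\<close> their sizes add up to \<open>card V\<close>.\<close>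

lemma nbrs_complement:
  assumes E: "E a b" "E a c" "E a d" "E b c" "E b d" "E c d"
    and ab: "codeg a b \<noteq> 4 \<or> card V = 8"
  shows "nbrs {c, d} = V - nbrs {a, b}"
proof -
  have \<sigma>: "{a, b, c, d} \<in> K4 {}" using K4_I[OF E] .
  have "nbrs {a, b} \<inter> nbrs {c, d} = nbrs {a, b, c, d}" unfolding nbrs_def by blast
  also have "\<dots> = {}" using no_K5 K4_D[OF \<sigma>] by blast
  finally have disj: "nbrs {a, b} \<inter> nbrs {c, d} = {}" .
  have sub: "nbrs {a, b} \<subseteq> V" "nbrs {c, d} \<subseteq> V" by (auto simp: nbrs_def)
  have "card (V - nbrs {a, b}) = codeg c d"
    using codeg_opposite[OF assms] sub by (simp add: card_Diff_subset)
  moreover have "nbrs {c, d} \<subseteq> V - nbrs {a, b}" using disj sub by blast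
  ultimately show ?thesis by (simp add: card_subset_eq)
qed

text \<open>One side consists of the vertices in the link of a suitable edge. The remaining vertices
  form the link of an opposite edge, so both sides are 2-regular. The number of edges then fixes
  their sizes.\<close>

theorem join_decomposition:
  obtains V1 V2 where "V = V1 \<union> V2" "V1 \<inter> V2 = {}" "\<forall>x\<in>V1. \<forall>y\<in>V2. E x y"
    "\<forall>x\<in>V1. card {y \<in> V1. E x y} = 2" "\<forall>x\<in>V2. card {y \<in> V2. E x y} = 2"
    "card V1 = card V div 2" "card V2 = (card V + 1) div 2"
proof -
  \<comment> \<open>If every edge has codegree 4, the vertices of a facet have degree 6, and
    \<open>24 = 2 * card V + 8\<close> leaves eight vertices.\<close>
  have "\<exists>a b. E a b \<and> (codeg a b \<noteq> 4 \<or> card V = 8)"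
  proof (rule ccontr)
    assume no: "\<not> ?thesis"
    obtain \<sigma> where \<sigma>: "\<sigma> \<in> K4 {}" using clique_extend[OF clique_empty] by blast
    note \<sigma>' = K4_D[OF \<sigma>]
    have "deg a + 6 = 12" if a: "a \<in> \<sigma>" for a
    proof -
      have "(\<Sum>x\<in>\<sigma> - {a}. codeg a x) = (\<Sum>x\<in>\<sigma> - {a}. 4)"
      proof (rule sum.cong)
        fix x assume "x \<in> \<sigma> - {a}"
        then have "E a x" using cliqueD[of \<sigma> a x] \<sigma>' a by blast
        then show "codeg a x = 4" using no by blast
      qed simp
      then show ?thesis using sum_codeg_K4[OF \<sigma> a] \<sigma>' a by simp
    qed
    then have "(\<Sum>v\<in>\<sigma>. deg v) = (\<Sum>v\<in>\<sigma>. 6)" by (intro sum.cong) auto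
    then have "card V = 8" using sum_deg_K4[OF \<sigma>] \<sigma>' by simp
    moreover have "\<exists>a b. E a b"
    proof -
      obtain a b where "a \<in> \<sigma>" "b \<in> \<sigma>" "a \<noteq> b"
        using \<sigma>' card_le_Suc0_iff_eq[of \<sigma>] by fastforce
      then show ?thesis using cliqueD \<sigma>' by blast
    qed
    ultimately show False using no by blast
  qed
  then obtain a b where ab: "E a b" "codeg a b \<noteq> 4 \<or> card V = 8" by blast
  define M where "M = nbrs {a, b}"
  \<comment> \<open>Each \<open>y\<close> in \<open>M\<close> lies in a facet \<open>abyz\<close>,
    whose edge \<open>yz\<close> is opposite to \<open>ab\<close>. Hence \<open>y\<close> is
    adjacent to all of \<open>V - M\<close>.\<close>
  have compl: "\<exists>z. E y z \<and> nbrs {y, z} = V - M" if "y \<in> M" for y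
  proof -
    have y: "y \<in> nbrs {a, b}" using that by (simp add: M_def)
    obtain z where z: "z \<in> nbrs {a, b}" "E y z" using edge_nbrs_edge[OF ab(1) y] by blast
    have "nbrs {y, z} = V - nbrs {a, b}"
      using y z ab by (intro nbrs_complement) (simp_all add: nbrs_def)
    then show ?thesis using z(2) M_def by blast
  qed
  have "M \<noteq> {}" using codeg_ge4[OF ab(1)] by (auto simp: M_def)
  then obtain c d where cd: "E c d" "nbrs {c, d} = V - M" using compl by blast
  have MV: "M \<subseteq> V" by (auto simp: M_def nbrs_def)
  have join: "E y w" if y: "y \<in> M" and w: "w \<in> V - M" for y w
  proof -
    obtain z where "nbrs {y, z} = V - M" using compl[OF y] by blast
    then have "w \<in> nbrs {y, z}" using w by simp
    then show ?thesis by (simp add: nbrs_def)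
  qed
  have regM: "card {y \<in> M. E x y} = 2" if "x \<in> M" for x
    using regular_edge_nbrs[OF ab(1)] that by (simp add: M_def)
  have regN: "card {y \<in> V - M. E x y} = 2" if "x \<in> V - M" for x
    using regular_edge_nbrs[OF cd(1)] that by (simp add: cd(2))
  define N where "N = V - M"
  have fin: "finite M" "finite N" using finite_subset[OF MV finite_V] by (simp_all add: N_def)
  have V: "V = M \<union> N" "M \<inter> N = {}" using MV by (auto simp: N_def)
  have join': "E y w" if "y \<in> M" "w \<in> N" for y w using join that by (simp add: N_def)
  have regN': "card {y \<in> N. E x y} = 2" if "x \<in> N" for x using regN that by (simp add: N_def)
  have degM: "deg x = 2 + card N" if x: "x \<in> M" for x
  proof -
    have "nbrs {x} = {y \<in> M. E x y} \<union> N" "{y \<in> M. E x y} \<inter> N = {}"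
      unfolding nbrs_def using V join[OF x] by (auto simp: N_def)
    then show ?thesis using regM[OF x] fin by (simp add: card_Un_disjoint)
  qed
  have degN: "deg x = 2 + card M" if x: "x \<in> N" for x
  proof -
    have "E x y" if "y \<in> M" for y using E_sym[OF join[OF that]] x by (simp add: N_def)
    then have "nbrs {x} = {y \<in> N. E x y} \<union> M" "{y \<in> N. E x y} \<inter> M = {}"
      unfolding nbrs_def using V by auto
    then show ?thesis using regN x fin by (simp add: card_Un_disjoint N_def)
  qed
  have cV: "card V = card M + card N" using V fin by (simp add: card_Un_disjoint)
  have "(\<Sum>v\<in>V. deg v) = (\<Sum>v\<in>M. deg v) + (\<Sum>v\<in>N. deg v)"
    using sum.union_disjoint[OF fin V(2)] V(1) by simp
  then have "(\<Sum>v\<in>V. deg v) = card M * (2 + card N) + card N * (2 + card M)"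
    using degM degN by simp
  \<comment> \<open>Edges inside the two sides contribute \<open>2 * card V\<close> to the degree
    sum; the rest is twice the product of the sizes.\<close>
  then have prod: "card M * card N = (card V div 2) * ((card V + 1) div 2)"
    using sum_deg cV by (simp add: algebra_simps)
  have "card M = card V div 2 \<and> card N = (card V + 1) div 2 \<or>
      card N = card V div 2 \<and> card M = (card V + 1) div 2"
  proof -
    define m where "m = int (card M)"
    define k where "k = int (card N)"
    define h where "h = int (card V div 2)"
    define p where "p = int ((card V + 1) div 2)"
    have "m + k = h + p" unfolding m_def k_def h_def p_def using cV by linarith
    moreover have "m * k = h * p"
      unfolding m_def k_def h_def p_def of_nat_mult[symmetric] prod ..
    \<comment> \<open>Two pairs with equal sum and equal product agree up to order.\<close>
    ultimately have "(m - h) * (m - p) = 0" by algebra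
    then have "m = h \<and> k = p \<or> k = h \<and> m = p" using \<open>m + k = h + p\<close> by auto
    then show ?thesis unfolding m_def k_def h_def p_def by (simp only: of_nat_eq_iff)
  qed
  moreover have joinMN: "\<forall>x\<in>M. \<forall>y\<in>N. E x y" and joinNM: "\<forall>x\<in>N. \<forall>y\<in>M. E x y"
    and regM': "\<forall>x\<in>M. card {y \<in> M. E x y} = 2" and regN'': "\<forall>x\<in>N. card {y \<in> N. E x y} = 2"
    using join' E_sym[OF join'] regM regN' by blast+
  ultimately show ?thesis
  proof (elim disjE)
    assume c: "card M = card V div 2 \<and> card N = (card V + 1) div 2"
    show ?thesis
      by (rule that[OF V joinMN regM' regN'' conjunct1[OF c] conjunct2[OF c]])
  next
    assume c: "card N = card V div 2 \<and> card M = (card V + 1) div 2"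
    have V': "V = N \<union> M" "N \<inter> M = {}" using V by blast+
    show ?thesis
      by (rule that[OF V' joinNM regN'' regM' conjunct1[OF c] conjunct2[OF c]])
  qed
qed

end

section \<open>Two-regular graphs\<close>

lemma Suc_mod_less: "i < n \<Longrightarrow> Suc i mod n = (if Suc i = n then 0 else Suc i)"
  by auto

lemma vertex_set_cycle_complex: "xs \<noteq> [] \<Longrightarrow> vertex_set (cycle_complex xs) = set xs"
  unfolding vertex_set_def cycle_complex_def by auto

lemma pair_in_cycle_complex:
  "x \<noteq> y \<Longrightarrow> {x, y} \<in> cycle_complex xs \<longleftrightarrow>
    (\<exists>i<length xs. {x, y} = {xs ! i, xs ! (Suc i mod length xs)})"
  unfolding cycle_complex_def by (auto simp: doubleton_eq_iff)

lemma card_cycle_complex_le: "\<tau> \<in> cycle_complex xs \<Longrightarrow> finite \<tau> \<and> card \<tau> \<le> 2"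
  unfolding cycle_complex_def by (auto simp: card_insert_if)

lemma cycle_complex_subset:
  assumes "\<tau> \<in> cycle_complex xs"
  shows "\<tau> \<subseteq> set xs"
proof -
  consider "\<tau> = {}" | x where "x \<in> set xs" "\<tau> = {x}"
    | i where "i < length xs" "\<tau> = {xs ! i, xs ! (Suc i mod length xs)}"
    using assms unfolding cycle_complex_def by blast
  then show ?thesis
  proof cases
    case (3 i)
    have "Suc i mod length xs < length xs" by (rule mod_less_divisor) (use 3 in linarith)
    then show ?thesis using 3 nth_mem by simp
  qed simp_all
qed

text \<open>\<open>E\<close> is a relation on the whole type, so that both sides of the join share
  it and \<open>W\<close> can shrink in an induction. Triangle-freeness provides the cycle lengths
  of at least 4 in \<open>GJ\<close>.\<close>

locale two_regular =
  fixes W :: "'a set" and E :: "'a \<Rightarrow> 'a \<Rightarrow> bool"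
  assumes finite_W: "finite W"
    and sym: "E x y \<Longrightarrow> E y x"
    and irrefl: "\<not> E x x"
    and two_nbrs: "x \<in> W \<Longrightarrow> card {y \<in> W. E x y} = 2"
    and triangle_free: "x \<in> W \<Longrightarrow> y \<in> W \<Longrightarrow> z \<in> W \<Longrightarrow> E x y \<Longrightarrow> E y z \<Longrightarrow> E z x \<Longrightarrow> False"
begin

lemma nbrs_eq:
  assumes "x \<in> W" "y \<in> W" "z \<in> W" "E x y" "E x z" "y \<noteq> z"
  shows "{w \<in> W. E x w} = {y, z}"
proof -
  have "{y, z} = {w \<in> W. E x w}"
    using assms two_nbrs[OF assms(1)] finite_W by (intro card_subset_eq) auto
  then show ?thesis ..
qed

text \<open>A longest path closes up: both neighbours of its first vertex lie on it, since otherwise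
  it could be extended, and the farther one must be its last vertex.\<close>

lemma exists_cycle:
  assumes "W \<noteq> {}"
  obtains xs where "distinct xs" "set xs \<subseteq> W" "length xs \<ge> 4"
    "\<forall>i<length xs. E (xs ! i) (xs ! (Suc i mod length xs))"
proof -
  define P where "P xs \<longleftrightarrow> distinct xs \<and> set xs \<subseteq> W \<and> xs \<noteq> [] \<and>
    (\<forall>i. Suc i < length xs \<longrightarrow> E (xs ! i) (xs ! Suc i))" for xs
  obtain x where x: "x \<in> W" using assms by blast
  have "P [x]" using x by (simp add: P_def)
  moreover have "\<forall>ys. P ys \<longrightarrow> length ys < Suc (card W)"
  proof (intro allI impI)
    fix ys assume "P ys"
    then have "length ys = card (set ys)" "set ys \<subseteq> W" by (auto simp: P_def distinct_card)
    then show "length ys < Suc (card W)" using card_mono[OF finite_W] by (simp add: less_Suc_eq_le)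
  qed
  ultimately obtain xs where xs: "P xs" and max: "\<And>ys. P ys \<Longrightarrow> length ys \<le> length xs"
    using ex_has_greatest_nat[of P "[x]" length] by blast
  have d: "distinct xs" "set xs \<subseteq> W" "xs \<noteq> []"
    and step: "\<And>i. Suc i < length xs \<Longrightarrow> E (xs ! i) (xs ! Suc i)" using xs by (auto simp: P_def)
  have inW: "xs ! i \<in> W" if "i < length xs" for i using d(2) that nth_mem by blast
  have neq: "xs ! i \<noteq> xs ! j" if "i < length xs" "j < length xs" "i \<noteq> j" for i j
    using d(1) that by (simp add: nth_eq_iff_index_eq)
  have closed: "y \<in> set xs" if y: "y \<in> W" "E (xs ! 0) y" for y
  proof (rule ccontr)
    assume "y \<notin> set xs"
    have "E ((y # xs) ! i) ((y # xs) ! Suc i)" if "Suc i < length (y # xs)" for i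
      using that step sym[OF y(2)] by (cases i) auto
    then have "P (y # xs)" using y(1) d \<open>y \<notin> set xs\<close> unfolding P_def by auto
    then show False using max by force
  qed
  have x0: "xs ! 0 \<in> W" using inW d(3) by simp
  obtain u v where uv: "{y \<in> W. E (xs ! 0) y} = {u, v}" "u \<noteq> v"
    using two_nbrs[OF x0] unfolding card_2_iff by blast
  \<comment> \<open>The two neighbours of the first vertex occupy different positive indices, so the
    larger index exceeds 1.\<close>
  have "\<exists>j k. 0 < j \<and> j < k \<and> k < length xs \<and> E (xs ! 0) (xs ! k)"
  proof -
    have uv': "E (xs ! 0) u" "E (xs ! 0) v" "u \<in> set xs" "v \<in> set xs" using uv(1) closed by auto
    then obtain j k where jk: "j < length xs" "xs ! j = u" "k < length xs" "xs ! k = v"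
      unfolding in_set_conv_nth by blast
    have "j \<noteq> 0" "k \<noteq> 0" using uv' jk irrefl by metis+
    moreover have "j \<noteq> k" using uv(2) jk by blast
    ultimately show ?thesis using uv' jk by (metis linorder_neqE_nat neq0_conv)
  qed
  then obtain k where k: "1 < k" "k < length xs" "E (xs ! 0) (xs ! k)" by (metis One_nat_def Suc_lessI less_trans)
  \<comment> \<open>With a successor on the path, \<open>xs ! k\<close> would have three neighbours,
    at the indices 0, \<open>k - 1\<close> and \<open>k + 1\<close>.\<close>
  have last: "Suc k = length xs"
  proof (rule ccontr)
    assume "Suc k \<noteq> length xs"
    then have Sk: "Suc k < length xs" using k(2) by simp
    have "E (xs ! k) (xs ! (k - 1))" using step[of "k - 1"] k sym by simp
    then have "{w \<in> W. E (xs ! k) w} = {xs ! (k - 1), xs ! 0}"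
      using k sym[OF k(3)] by (intro nbrs_eq inW neq) auto
    moreover have "xs ! Suc k \<in> {w \<in> W. E (xs ! k) w}" using step[OF Sk] inW[OF Sk] by simp
    moreover have "k - 1 < length xs" "Suc k \<noteq> k - 1" using k by linarith+
    ultimately show False using neq[of "Suc k" "k - 1"] neq[of "Suc k" 0] Sk k d(3) by auto
  qed
  have cyc: "E (xs ! i) (xs ! (Suc i mod length xs))" if "i < length xs" for i
  proof (cases "Suc i = length xs")
    case True
    then have "i = k" using last by simp
    then show ?thesis using True sym[OF k(3)] by simp
  next
    case False
    then show ?thesis using that step by simp
  qed
  have "length xs \<noteq> 3"
  proof
    assume l3: "length xs = 3"
    then have "E (xs ! 0) (xs ! 1)" "E (xs ! 1) (xs ! 2)" "E (xs ! 2) (xs ! 0)"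
      using cyc[of 0, unfolded l3] cyc[of 1, unfolded l3] cyc[of 2, unfolded l3]
      by (simp_all add: numeral_2_eq_2)
    then show False by (rule triangle_free[rotated 3]) (use inW l3 in simp_all)
  qed
  then have "length xs \<ge> 4" using k last by linarith
  moreover have "\<forall>i<length xs. E (xs ! i) (xs ! (Suc i mod length xs))"
    by (intro allI impI cyc)
  ultimately show ?thesis by (rule that[OF d(1,2)])
qed

text \<open>The predecessor and the successor of a vertex of the cycle already are its two
  neighbours in \<open>W\<close>. So the cycle has no chords and no edge leaves it.\<close>

lemma cycle_closed:
  assumes xs: "distinct xs" "set xs \<subseteq> W" "length xs \<ge> 4"
    and cyc: "\<forall>i<length xs. E (xs ! i) (xs ! (Suc i mod length xs))"
    and x: "x \<in> set xs" and y: "y \<in> W"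
  shows "E x y \<longleftrightarrow> x \<noteq> y \<and> {x, y} \<in> cycle_complex xs"
proof
  let ?n = "length xs"
  have inW: "xs ! i \<in> W" if "i < ?n" for i using xs(2) that nth_mem by blast
  assume E: "E x y"
  then have ne: "x \<noteq> y" using irrefl by blast
  obtain i where i: "i < ?n" "x = xs ! i" using x unfolding in_set_conv_nth by blast
  \<comment> \<open>\<open>j\<close> is the cyclic predecessor of \<open>i\<close>; it differs from
    the cyclic successor since the length exceeds 2.\<close>
  define j where "j = (if i = 0 then ?n - 1 else i - 1)"
  have j: "j < ?n" "Suc j mod ?n = i" using i xs(3) by (auto simp: j_def)
  have s: "Suc i mod ?n < ?n" by (rule mod_less_divisor) (use i in linarith)
  have "Suc i mod ?n \<noteq> j" using i xs(3) by (auto simp: j_def Suc_mod_less)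
  then have "xs ! (Suc i mod ?n) \<noteq> xs ! j" using xs(1) s j by (simp add: nth_eq_iff_index_eq)
  moreover have "E (xs ! i) (xs ! j)" using cyc[rule_format, OF j(1)] j(2) sym by simp
  ultimately have "{w \<in> W. E (xs ! i) w} = {xs ! (Suc i mod ?n), xs ! j}"
    using cyc[rule_format, OF i(1)] by (intro nbrs_eq inW i s j)
  then have "y = xs ! (Suc i mod ?n) \<or> y = xs ! j" using E y i by blast
  then have "\<exists>i<?n. {x, y} = {xs ! i, xs ! (Suc i mod ?n)}"
  proof
    assume "y = xs ! j"
    then have "{x, y} = {xs ! j, xs ! (Suc j mod ?n)}" using i j by auto
    then show ?thesis using j by blast
  qed (use i in blast)
  then show "x \<noteq> y \<and> {x, y} \<in> cycle_complex xs" using ne pair_in_cycle_complex[OF ne] by blast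
next
  assume "x \<noteq> y \<and> {x, y} \<in> cycle_complex xs"
  then obtain i where "i < length xs" "{x, y} = {xs ! i, xs ! (Suc i mod length xs)}"
    using pair_in_cycle_complex by metis
  then show "E x y" using cyc[rule_format, of i] sym by (auto simp: doubleton_eq_iff)
qed

end

text \<open>One cycle is split off; as no edge leaves it, the rest is again 2-regular. Because
  \<open>y\<close> ranges over all of \<open>W\<close>, the last clause also records that different
  cycles are not adjacent.\<close>

lemma two_regular_decomposition:
  assumes "two_regular W E"
  shows "\<exists>(s::nat) L. (\<forall>i\<in>{1..s}. distinct (L i) \<and> length (L i) \<ge> 4) \<and>
    disjoint_family_on (\<lambda>i. set (L i)) {1..s} \<and> (\<Union>i\<in>{1..s}. set (L i)) = W \<and>
    (\<forall>i\<in>{1..s}. \<forall>x\<in>set (L i). \<forall>y\<in>W. E x y \<longleftrightarrow> x \<noteq> y \<and> {x, y} \<in> cycle_complex (L i))"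
  using assms
proof (induction "card W" arbitrary: W rule: less_induct)
  case less
  interpret two_regular W E by (rule less.prems)
  show ?case
  proof (cases "W = {}")
    case True
    then show ?thesis by (intro exI[of _ 0]) (simp add: disjoint_family_on_def)
  next
    case False
    then obtain xs where xs: "distinct xs" "set xs \<subseteq> W" "length xs \<ge> 4"
      "\<forall>i<length xs. E (xs ! i) (xs ! (Suc i mod length xs))"
      by (rule exists_cycle)
    note closed = cycle_closed[OF xs]
    have closed': "y \<in> set xs" if "x \<in> set xs" "y \<in> W" "E x y" for x y
    proof -
      have "{x, y} \<in> cycle_complex xs" using closed that by blast
      then show ?thesis using cycle_complex_subset by blast
    qed
    define W' where "W' = W - set xs"
    have "xs \<noteq> []" using xs(3) by auto
    then have "W' \<subset> W" using xs(2) unfolding W'_def by (cases xs) auto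
    then have card: "card W' < card W" using finite_W by (simp add: psubset_card_mono)
    have "two_regular W' E"
    proof
      show "card {y \<in> W'. E x y} = 2" if x: "x \<in> W'" for x
      proof -
        have "y \<notin> set xs" if "y \<in> W" "E x y" for y
          using closed'[of y x] sym[OF that(2)] x by (auto simp: W'_def)
        then have "{y \<in> W'. E x y} = {y \<in> W. E x y}" by (auto simp: W'_def)
        then show ?thesis using two_nbrs x by (simp add: W'_def)
      qed
      show False if "x \<in> W'" "y \<in> W'" "z \<in> W'" "E x y" "E y z" "E z x" for x y z
        using triangle_free[of x y z] that by (simp add: W'_def)
    qed (use finite_W sym irrefl in \<open>simp_all add: W'_def\<close>)
    from less.hyps[OF card this] obtain s :: nat and L where
      L: "\<forall>i\<in>{1..s}. distinct (L i) \<and> length (L i) \<ge> 4"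
      "disjoint_family_on (\<lambda>i. set (L i)) {1..s}" "(\<Union>i\<in>{1..s}. set (L i)) = W'"
      "\<forall>i\<in>{1..s}. \<forall>x\<in>set (L i). \<forall>y\<in>W'. E x y \<longleftrightarrow> x \<noteq> y \<and> {x, y} \<in> cycle_complex (L i)"
      by blast
    define M where "M = L(Suc s := xs)"
    have M: "M (Suc s) = xs" "\<And>i. i \<in> {1..s} \<Longrightarrow> M i = L i" by (auto simp: M_def)
    have ivl: "{1..Suc s} = insert (Suc s) {1..s}" by auto
    have union': "(\<Union>i\<in>{1..s}. set (M i)) = W'" using L(3) M(2) by simp
    have "disjoint_family_on (\<lambda>i. set (M i)) {1..s}"
      using L(2) M(2) unfolding disjoint_family_on_def by simp
    then have "disjoint_family_on (\<lambda>i. set (M i)) {1..Suc s}"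
      unfolding ivl using union' by (subst disjoint_family_on_insert) (auto simp: M(1) W'_def)
    moreover have "(\<Union>i\<in>{1..Suc s}. set (M i)) = W"
      unfolding ivl using union' xs(2) by (auto simp: M(1) W'_def)
    moreover have "E x y \<longleftrightarrow> x \<noteq> y \<and> {x, y} \<in> cycle_complex (M i)"
      if i: "i \<in> {1..Suc s}" and x: "x \<in> set (M i)" and y: "y \<in> W" for i x y
    proof (cases "i = Suc s")
      case True
      then show ?thesis using closed x y M(1) by simp
    next
      case False
      then have i': "i \<in> {1..s}" using i by simp
      then have xL: "x \<in> set (L i)" "x \<in> W'" using x M(2) L(3) by auto
      show ?thesis
      proof (cases "y \<in> W'")
        case True
        then show ?thesis using L(4) i' xL M(2) by simp
      next
        case False
        then have "y \<in> set xs" using y by (simp add: W'_def)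
        then have "\<not> E x y" using closed'[of y x] sym xL(2) by (auto simp: W'_def)
        moreover have "y \<notin> set (L i)" using False L(3) i' by blast
        then have "{x, y} \<notin> cycle_complex (M i)"
          using cycle_complex_subset[of "{x, y}" "L i"] M(2)[OF i'] by auto
        ultimately show ?thesis by blast
      qed
    qed
    moreover have "\<forall>i\<in>{1..Suc s}. distinct (M i) \<and> length (M i) \<ge> 4"
      unfolding ivl using L(1) M xs by simp
    ultimately show ?thesis by blast
  qed
qed

text \<open>Without triangles a clique is empty, a vertex or an edge, and the edges are those of the
  cycles.\<close>

theorem two_regular_cycles:
  assumes "two_regular W E" "W \<noteq> {}"
  obtains s :: nat and L where "\<forall>i\<in>{1..s}. distinct (L i) \<and> length (L i) \<ge> 4"
    "disjoint_family_on (\<lambda>i. set (L i)) {1..s}" "(\<Union>i\<in>{1..s}. set (L i)) = W"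
    "{\<tau>. \<tau> \<subseteq> W \<and> (\<forall>x\<in>\<tau>. \<forall>y\<in>\<tau>. x \<noteq> y \<longrightarrow> E x y)} = (\<Union>i\<in>{1..s}. cycle_complex (L i))"
proof -
  interpret two_regular W E by (rule assms)
  obtain s :: nat and L where L: "\<forall>i\<in>{1..s}. distinct (L i) \<and> length (L i) \<ge> 4"
    "disjoint_family_on (\<lambda>i. set (L i)) {1..s}" "(\<Union>i\<in>{1..s}. set (L i)) = W"
    "\<forall>i\<in>{1..s}. \<forall>x\<in>set (L i). \<forall>y\<in>W. E x y \<longleftrightarrow> x \<noteq> y \<and> {x, y} \<in> cycle_complex (L i)"
    using two_regular_decomposition[OF assms(1)] by blast
  have "\<tau> \<in> (\<Union>i\<in>{1..s}. cycle_complex (L i))"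
    if \<tau>: "\<tau> \<subseteq> W" "\<And>x y. x \<in> \<tau> \<Longrightarrow> y \<in> \<tau> \<Longrightarrow> x \<noteq> y \<Longrightarrow> E x y" for \<tau>
  proof (cases "\<tau> = {}")
    case True
    \<comment> \<open>The empty face belongs to the union only if there is at least one
      cycle.\<close>
    have "{1..s} \<noteq> {}" using L(3) assms(2) by auto
    then show ?thesis using True by (auto simp: cycle_complex_def)
  next
    case False
    then obtain x where x: "x \<in> \<tau>" by blast
    then obtain i where i: "i \<in> {1..s}" "x \<in> set (L i)" using \<tau>(1) L(3) by blast
    show ?thesis
    proof (cases "\<tau> = {x}")
      case True
      then have "\<tau> \<in> cycle_complex (L i)" using i by (simp add: cycle_complex_def)
      then show ?thesis using i by blast
    next
      case False
      then obtain y where y: "y \<in> \<tau>" "y \<noteq> x" using x by blast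
      have "z = x \<or> z = y" if z: "z \<in> \<tau>" for z
      proof (rule ccontr)
        assume "\<not> (z = x \<or> z = y)"
        then have "E x y" "E y z" "E z x" using \<tau>(2) x y z by blast+
        then show False using triangle_free[of x y z] x y z \<tau>(1) by blast
      qed
      then have "\<tau> = {x, y}" using x y by blast
      moreover have "E x y" using \<tau>(2) x y by blast
      then have "{x, y} \<in> cycle_complex (L i)" using L(4) i y \<tau>(1) by blast
      ultimately show ?thesis using i by blast
    qed
  qed
  moreover have "\<tau> \<subseteq> W \<and> (\<forall>x\<in>\<tau>. \<forall>y\<in>\<tau>. x \<noteq> y \<longrightarrow> E x y)"
    if i: "i \<in> {1..s}" and \<tau>: "\<tau> \<in> cycle_complex (L i)" for i \<tau>
  proof (intro conjI ballI impI)
    have sub: "\<tau> \<subseteq> set (L i)" using cycle_complex_subset[OF \<tau>] .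
    then show W: "\<tau> \<subseteq> W" using L(3) i by blast
    fix x y assume xy: "x \<in> \<tau>" "y \<in> \<tau>" "x \<noteq> y"
    \<comment> \<open>A face of a cycle has at most two elements, so two distinct ones exhaust
      it.\<close>
    have "{x, y} = \<tau>"
      using xy card_cycle_complex_le[OF \<tau>] by (intro card_seteq) auto
    then show "E x y" using L(4) i xy sub W \<tau> by blast
  qed
  ultimately have "{\<tau>. \<tau> \<subseteq> W \<and> (\<forall>x\<in>\<tau>. \<forall>y\<in>\<tau>. x \<noteq> y \<longrightarrow> E x y)} = (\<Union>i\<in>{1..s}. cycle_complex (L i))"
    by (intro set_eqI iffI) (simp, elim UN_E, simp)
  then show ?thesis by (rule that[OF L(1-3)])
qed

section \<open>Links in flag Eulerian complexes\<close>

lemma simplicial_complexD: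
  assumes "is_simplicial_complex \<Delta>"
  shows "finite \<Delta>" "\<sigma> \<in> \<Delta> \<Longrightarrow> finite \<sigma>" "{} \<in> \<Delta>" "\<sigma> \<in> \<Delta> \<Longrightarrow> \<tau> \<subseteq> \<sigma> \<Longrightarrow> \<tau> \<in> \<Delta>"
  using assms unfolding is_simplicial_complex_def by blast+

lemma face_dim_le: "finite \<Delta> \<Longrightarrow> \<sigma> \<in> \<Delta> \<Longrightarrow> face_dim \<sigma> \<le> complex_dim \<Delta>"
  unfolding complex_dim_def by simp

lemma link_simplicial_complex:
  assumes \<Delta>: "is_simplicial_complex \<Delta>" and \<sigma>: "\<sigma> \<in> \<Delta>"
  shows "is_simplicial_complex (face_link \<Delta> \<sigma>)"
  unfolding is_simplicial_complex_def
proof (intro conjI ballI allI impI)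
  have img: "face_link \<Delta> \<sigma> = (\<lambda>\<tau>. \<tau> - \<sigma>) ` {\<tau> \<in> \<Delta>. \<sigma> \<subseteq> \<tau>}"
    unfolding face_link_def by blast
  show "finite (face_link \<Delta> \<sigma>)" unfolding img using simplicial_complexD(1)[OF \<Delta>] by simp
  show "{} \<in> face_link \<Delta> \<sigma>" unfolding img using \<sigma> by blast
  fix \<rho> assume "\<rho> \<in> face_link \<Delta> \<sigma>"
  then obtain \<tau> where \<tau>: "\<tau> \<in> \<Delta>" "\<sigma> \<subseteq> \<tau>" "\<rho> = \<tau> - \<sigma>" unfolding img by blast
  show "finite \<rho>" using simplicial_complexD(2)[OF \<Delta> \<tau>(1)] \<tau>(3) by simp
  fix \<rho>' assume "\<rho>' \<subseteq> \<rho>"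
  then have "\<sigma> \<union> \<rho>' \<in> \<Delta>" "\<rho>' = (\<sigma> \<union> \<rho>') - \<sigma>"
    using simplicial_complexD(4)[OF \<Delta> \<tau>(1), of "\<sigma> \<union> \<rho>'"] \<tau> by blast+
  then show "\<rho>' \<in> face_link \<Delta> \<sigma>" unfolding img by blast
qed

text \<open>Removing \<open>\<sigma>\<close> identifies these with the faces of the link that have
  \<open>j\<close> vertices, that is, dimension \<open>j - 1\<close>. The counting can thus stay in
  \<open>\<Delta>\<close>.\<close>

definition cofaces :: "'a set set \<Rightarrow> 'a set \<Rightarrow> nat \<Rightarrow> 'a set set" where
  "cofaces \<Delta> \<sigma> j = {\<tau> \<in> \<Delta>. \<sigma> \<subseteq> \<tau> \<and> card \<tau> = card \<sigma> + j}"

lemma card_link_faces: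
  assumes \<Delta>: "is_simplicial_complex \<Delta>" and \<sigma>: "\<sigma> \<in> \<Delta>"
  shows "card {\<rho> \<in> face_link \<Delta> \<sigma>. face_dim \<rho> = int j - 1} = card (cofaces \<Delta> \<sigma> j)"
proof -
  have dim: "face_dim (\<tau> - \<sigma>) = int j - 1 \<longleftrightarrow> card \<tau> = card \<sigma> + j"
    if "\<tau> \<in> \<Delta>" "\<sigma> \<subseteq> \<tau>" for \<tau>
  proof -
    have "finite \<tau>" "finite \<sigma>" using simplicial_complexD(2)[OF \<Delta>] that \<sigma> by blast+
    then have "card (\<tau> - \<sigma>) + card \<sigma> = card \<tau>"
      using that by (simp add: card_Diff_subset card_mono)
    then show ?thesis unfolding face_dim_def by linarith
  qed
  have "{\<rho> \<in> face_link \<Delta> \<sigma>. face_dim \<rho> = int j - 1} = (\<lambda>\<tau>. \<tau> - \<sigma>) ` cofaces \<Delta> \<sigma> j"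
    unfolding face_link_def cofaces_def using dim by blast
  moreover have "inj_on (\<lambda>\<tau>. \<tau> - \<sigma>) (cofaces \<Delta> \<sigma> j)"
    unfolding cofaces_def inj_on_def by blast
  ultimately show ?thesis by (simp add: card_image)
qed

lemma pure_coface:
  assumes \<Delta>: "is_simplicial_complex \<Delta>" and pure: "pure_complex \<Delta>" and \<sigma>: "\<sigma> \<in> \<Delta>"
  obtains \<tau> where "\<tau> \<in> \<Delta>" "\<sigma> \<subseteq> \<tau>" "face_dim \<tau> = complex_dim \<Delta>"
proof -
  obtain \<tau> where "\<tau> \<in> \<Delta>" "\<sigma> \<subseteq> \<tau>" "\<forall>\<rho>\<in>\<Delta>. \<tau> \<subseteq> \<rho> \<longrightarrow> \<tau> = \<rho>"
    using finite_has_maximal2[OF simplicial_complexD(1)[OF \<Delta>] \<sigma>] by blast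
  moreover from this have "facet \<Delta> \<tau>" unfolding facet_def by blast
  ultimately show ?thesis using pure that unfolding pure_complex_def by blast
qed

text \<open>By purity some face of top dimension contains \<open>\<sigma>\<close>, and removing
  \<open>\<sigma>\<close> from it attains the maximum.\<close>

lemma link_dim:
  assumes \<Delta>: "is_simplicial_complex \<Delta>" and pure: "pure_complex \<Delta>" and \<sigma>: "\<sigma> \<in> \<Delta>"
  shows "complex_dim (face_link \<Delta> \<sigma>) = complex_dim \<Delta> - int (card \<sigma>)"
  unfolding complex_dim_def[of "face_link \<Delta> \<sigma>"]
proof (rule Max_eqI)
  show "finite (face_dim ` face_link \<Delta> \<sigma>)"
    using simplicial_complexD(1)[OF link_simplicial_complex[OF \<Delta> \<sigma>]] by simp
  have dim: "face_dim (\<tau> - \<sigma>) = face_dim \<tau> - int (card \<sigma>)" if "\<tau> \<in> \<Delta>" "\<sigma> \<subseteq> \<tau>" for \<tau>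
  proof -
    have "finite \<tau>" "finite \<sigma>" using simplicial_complexD(2)[OF \<Delta>] that \<sigma> by blast+
    then have "card (\<tau> - \<sigma>) + card \<sigma> = card \<tau>"
      using that by (simp add: card_Diff_subset card_mono)
    then show ?thesis unfolding face_dim_def by linarith
  qed
  fix y assume "y \<in> face_dim ` face_link \<Delta> \<sigma>"
  then obtain \<tau> where \<tau>: "\<tau> \<in> \<Delta>" "\<sigma> \<subseteq> \<tau>" "y = face_dim (\<tau> - \<sigma>)" unfolding face_link_def by blast
  then show "y \<le> complex_dim \<Delta> - int (card \<sigma>)"
    using dim[OF \<tau>(1,2)] face_dim_le[OF simplicial_complexD(1)[OF \<Delta>] \<tau>(1)] by simp
next
  obtain \<tau> where \<tau>: "\<tau> \<in> \<Delta>" "\<sigma> \<subseteq> \<tau>" "face_dim \<tau> = complex_dim \<Delta>"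
    by (rule pure_coface[OF assms])
  have "finite \<tau>" "finite \<sigma>" using simplicial_complexD(2)[OF \<Delta>] \<tau> \<sigma> by blast+
  then have "card (\<tau> - \<sigma>) + card \<sigma> = card \<tau>"
    using \<tau> by (simp add: card_Diff_subset card_mono)
  then have "complex_dim \<Delta> - int (card \<sigma>) = face_dim (\<tau> - \<sigma>)"
    using \<tau>(3) unfolding face_dim_def by linarith
  moreover have "\<tau> - \<sigma> \<in> face_link \<Delta> \<sigma>" unfolding face_link_def using \<tau> by blast
  ultimately show "complex_dim \<Delta> - int (card \<sigma>) \<in> face_dim ` face_link \<Delta> \<sigma>" by blast
qed

text \<open>The Euler-Poincare formula turns the Eulerian condition into a relation between face
  numbers. The shift in \<open>nat (i + 1)\<close> comes from counting vertices instead of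
  dimension.\<close>

lemma eulerian_link_count:
  assumes \<Delta>: "is_simplicial_complex \<Delta>" and eul: "eulerian_complex TYPE('k::field) \<Delta>"
    and \<sigma>: "\<sigma> \<in> \<Delta>"
  shows "(\<Sum>i = - 1..complex_dim \<Delta> - int (card \<sigma>).
      neg_one_pow i * int (card (cofaces \<Delta> \<sigma> (nat (i + 1))))) =
    neg_one_pow (complex_dim \<Delta> - int (card \<sigma>))"
proof -
  have pure: "pure_complex \<Delta>" using eul by (simp add: eulerian_complex_def)
  have dim: "complex_dim (face_link \<Delta> \<sigma>) = complex_dim \<Delta> - int (card \<sigma>)"
    by (rule link_dim[OF \<Delta> pure \<sigma>])
  have "(\<Sum>i = - 1..complex_dim \<Delta> - int (card \<sigma>).
      neg_one_pow i * int (card (cofaces \<Delta> \<sigma> (nat (i + 1))))) =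
    (\<Sum>i = - 1..complex_dim (face_link \<Delta> \<sigma>).
      neg_one_pow i * int (card {\<rho> \<in> face_link \<Delta> \<sigma>. face_dim \<rho> = i}))"
  proof (rule sum.cong)
    fix i assume "i \<in> {- 1..complex_dim (face_link \<Delta> \<sigma>)}"
    then have "int (nat (i + 1)) - 1 = i" by simp
    then show "neg_one_pow i * int (card (cofaces \<Delta> \<sigma> (nat (i + 1)))) =
        neg_one_pow i * int (card {\<rho> \<in> face_link \<Delta> \<sigma>. face_dim \<rho> = i})"
      using card_link_faces[OF \<Delta> \<sigma>, of "nat (i + 1)"] by simp
  qed (simp add: dim)
  also have "\<dots> = reduced_euler_char TYPE('k) (face_link \<Delta> \<sigma>)"
    by (rule euler_poincare[OF link_simplicial_complex[OF \<Delta> \<sigma>], symmetric])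
  also have "\<dots> = neg_one_pow (complex_dim \<Delta> - int (card \<sigma>))"
    using eul \<sigma> unfolding eulerian_complex_def dim[symmetric] by blast
  finally show ?thesis .
qed

section \<open>The graph of a flag Eulerian complex of dimension 3\<close>

text \<open>The parameter \<open>field_type\<close> ties the coefficient field \<open>'k\<close> to
  the locale, since the type of \<open>\<Delta>\<close> does not mention it.\<close>

locale flag_eulerian_3 =
  fixes \<Delta> :: "'a set set" and field_type :: "'k::field itself"
  assumes complex: "is_simplicial_complex \<Delta>"
    and flag: "flag_complex \<Delta>"
    and dim3: "complex_dim \<Delta> = 3"
    and eulerian: "eulerian_complex TYPE('k) \<Delta>"
begin

definition adj :: "'a \<Rightarrow> 'a \<Rightarrow> bool" where
  "adj x y \<longleftrightarrow> x \<noteq> y \<and> {x, y} \<in> \<Delta>"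

lemmas complexD = simplicial_complexD[OF complex]

lemma finite_vertex_set: "finite (vertex_set \<Delta>)"
  unfolding vertex_set_def using complexD(1,2) by blast

sublocale graph "vertex_set \<Delta>" adj
proof
  show "finite (vertex_set \<Delta>)" by (rule finite_vertex_set)
  show "adj y x" if "adj x y" for x y using that unfolding adj_def by (metis insert_commute)
  show "\<not> adj x x" for x by (simp add: adj_def)
  show "x \<in> vertex_set \<Delta>" if "adj x y" for x y using that unfolding adj_def vertex_set_def by blast
qed

text \<open>A smallest clique that is not a face would be a minimal non-face, hence by flagness a
  pair; but adjacent pairs are faces.\<close>

lemma clique_iff: "clique \<sigma> \<longleftrightarrow> \<sigma> \<in> \<Delta>"
proof
  assume \<sigma>: "\<sigma> \<in> \<Delta>"
  have "adj x y" if "x \<in> \<sigma>" "y \<in> \<sigma>" "x \<noteq> y" for x y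
    using complexD(4)[OF \<sigma>, of "{x, y}"] that by (simp add: adj_def)
  moreover have "\<sigma> \<subseteq> vertex_set \<Delta>" using \<sigma> unfolding vertex_set_def by blast
  ultimately show "clique \<sigma>" unfolding clique_def by blast
next
  assume c: "clique \<sigma>"
  from finite_clique[OF c] c show "\<sigma> \<in> \<Delta>"
  proof (induction \<sigma> rule: finite_psubset_induct)
    case (psubset \<sigma>)
    show ?case
    proof (rule ccontr)
      assume no: "\<sigma> \<notin> \<Delta>"
      have "\<tau> \<in> \<Delta>" if "\<tau> \<subset> \<sigma>" for \<tau>
        using psubset.IH[OF that] clique_subset[OF psubset.prems] that by blast
      then have "minimal_nonface \<Delta> \<sigma>"
        using no psubset.prems unfolding minimal_nonface_def clique_def by blast
      then have "card \<sigma> = 2" using flag unfolding flag_complex_def by blast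
      then obtain x y where xy: "\<sigma> = {x, y}" "x \<noteq> y" unfolding card_2_iff by blast
      then have "adj x y" using cliqueD[OF psubset.prems, of x y] by blast
      then show False using no xy by (simp add: adj_def)
    qed
  qed
qed

lemma K4_eq: "K4 S = {\<sigma> \<in> \<Delta>. S \<subseteq> \<sigma> \<and> card \<sigma> = 4}"
  unfolding K4_def clique_iff by blast

lemma card_face_le: "\<sigma> \<in> \<Delta> \<Longrightarrow> card \<sigma> \<le> 4"
  using face_dim_le[OF complexD(1), of \<sigma>] dim3 by (simp add: face_dim_def)

lemma pure: "pure_complex \<Delta>" using eulerian by (simp add: eulerian_complex_def)

text \<open>By \<open>clique_iff\<close>, a vertex outside \<open>\<sigma>\<close> extends it to a
  face exactly if it is a common neighbour.\<close>

lemma card_cofaces_1: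
  assumes \<sigma>: "\<sigma> \<in> \<Delta>"
  shows "card (cofaces \<Delta> \<sigma> 1) = card (nbrs \<sigma>)"
proof -
  have fin: "finite \<sigma>" using complexD(2)[OF \<sigma>] .
  have ins: "insert w \<sigma> \<in> \<Delta> \<longleftrightarrow> w \<in> nbrs \<sigma>" if "w \<notin> \<sigma>" for w
    using clique_insert[of w \<sigma>] \<sigma> that unfolding clique_iff nbrs_def by blast
  have "cofaces \<Delta> \<sigma> 1 = (\<lambda>w. insert w \<sigma>) ` nbrs \<sigma>"
  proof (intro set_eqI iffI)
    fix \<tau> assume "\<tau> \<in> cofaces \<Delta> \<sigma> 1"
    then have \<tau>: "\<tau> \<in> \<Delta>" "\<sigma> \<subseteq> \<tau>" "card \<tau> = card \<sigma> + 1" by (auto simp: cofaces_def)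
    then have "card (\<tau> - \<sigma>) = 1" using fin by (simp add: card_Diff_subset)
    then obtain w where w: "\<tau> - \<sigma> = {w}" by (rule card_1_singletonE)
    then have "\<tau> = insert w \<sigma>" "w \<notin> \<sigma>" using \<tau>(2) by blast+
    then show "\<tau> \<in> (\<lambda>w. insert w \<sigma>) ` nbrs \<sigma>" using ins \<tau>(1) by blast
  next
    fix \<tau> assume "\<tau> \<in> (\<lambda>w. insert w \<sigma>) ` nbrs \<sigma>"
    then obtain w where w: "w \<in> nbrs \<sigma>" "\<tau> = insert w \<sigma>" by blast
    then have "w \<notin> \<sigma>" using nbrs_disjoint by blast
    then show "\<tau> \<in> cofaces \<Delta> \<sigma> 1" using w ins fin by (auto simp: cofaces_def)
  qed
  moreover have "inj_on (\<lambda>w. insert w \<sigma>) (nbrs \<sigma>)"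
    using nbrs_disjoint[of \<sigma>] unfolding inj_on_def by blast
  ultimately show ?thesis by (simp add: card_image)
qed

lemma cofaces_0: "\<sigma> \<in> \<Delta> \<Longrightarrow> cofaces \<Delta> \<sigma> 0 = {\<sigma>}"
  using card_subset_eq[OF complexD(2), of _ \<sigma>] unfolding cofaces_def by (intro set_eqI) (simp, metis order_refl)

text \<open>The link of a triangle has dimension 0, and its Eulerian relation reads
  \<open>-1 + card (nbrs \<tau>) = 1\<close>.\<close>

lemma card_nbrs_triangle':
  assumes "\<tau> \<in> \<Delta>" "card \<tau> = 3"
  shows "card (nbrs \<tau>) = 2"
proof -
  have "{- 1..3 - int (card \<tau>)} = {- 1, 0}" using assms(2) by auto
  then show ?thesis
    using eulerian_link_count[OF complex eulerian assms(1)] assms(2)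
      cofaces_0[OF assms(1)] card_cofaces_1[OF assms(1)]
    by (simp add: dim3 neg_one_pow_def)
qed

text \<open>In the link of \<open>v\<close>, each edge lies in two triangles and each triangle has
  three edges.\<close>

lemma card_K4_triangle_vertex:
  "2 * card (cofaces \<Delta> {v} 2) = 3 * card (cofaces \<Delta> {v} 3)"
proof -
  let ?T = "cofaces \<Delta> {v} 2" and ?S = "cofaces \<Delta> {v} 3"
  have fin: "finite ?T" "finite ?S" using complexD(1) by (simp_all add: cofaces_def)
  have "card {\<sigma> \<in> ?S. \<tau> \<subseteq> \<sigma>} = 2" if \<tau>: "\<tau> \<in> ?T" for \<tau>
  proof -
    have "\<tau> \<in> \<Delta>" "card \<tau> = 3" "v \<in> \<tau>" using \<tau> by (auto simp: cofaces_def)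
    then have "card (cofaces \<Delta> \<tau> 1) = 2" using card_cofaces_1 card_nbrs_triangle' by simp
    moreover have "{\<sigma> \<in> ?S. \<tau> \<subseteq> \<sigma>} = cofaces \<Delta> \<tau> 1"
      using \<open>card \<tau> = 3\<close> \<open>v \<in> \<tau>\<close> unfolding cofaces_def by auto
    ultimately show ?thesis by simp
  qed
  then have "2 * card ?T = (\<Sum>\<tau>\<in>?T. card {\<sigma> \<in> ?S. \<tau> \<subseteq> \<sigma>})" by simp
  also have "\<dots> = (\<Sum>\<sigma>\<in>?S. card {\<tau> \<in> ?T. \<tau> \<subseteq> \<sigma>})"
    using sum.swap_restrict[OF fin, of "\<lambda>_ _. 1::nat" "(\<subseteq>)"] by simp
  also have "\<dots> = (\<Sum>\<sigma>\<in>?S. 3)"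
  proof (rule sum.cong)
    fix \<sigma> assume "\<sigma> \<in> ?S"
    then have \<sigma>: "\<sigma> \<in> \<Delta>" "v \<in> \<sigma>" "card \<sigma> = 4" by (auto simp: cofaces_def)
    have finS: "finite \<sigma>" using complexD(2)[OF \<sigma>(1)] .
    have "{\<tau> \<in> ?T. \<tau> \<subseteq> \<sigma>} = (\<lambda>w. \<sigma> - {w}) ` (\<sigma> - {v})"
    proof (intro set_eqI iffI)
      fix \<tau> assume "\<tau> \<in> {\<tau> \<in> ?T. \<tau> \<subseteq> \<sigma>}"
      then have \<tau>: "v \<in> \<tau>" "card \<tau> = 3" "\<tau> \<subseteq> \<sigma>" by (auto simp: cofaces_def)
      then have "card (\<sigma> - \<tau>) = 1"
        using \<sigma>(3) finite_subset[OF \<tau>(3) finS] by (simp add: card_Diff_subset)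
      then obtain w where w: "\<sigma> - \<tau> = {w}" by (rule card_1_singletonE)
      then have "\<tau> = \<sigma> - {w}" "w \<in> \<sigma> - {v}" using \<tau> by blast+
      then show "\<tau> \<in> (\<lambda>w. \<sigma> - {w}) ` (\<sigma> - {v})" by blast
    next
      fix \<tau> assume "\<tau> \<in> (\<lambda>w. \<sigma> - {w}) ` (\<sigma> - {v})"
      then obtain w where w: "w \<in> \<sigma>" "w \<noteq> v" "\<tau> = \<sigma> - {w}" by blast
      then have "\<tau> \<in> \<Delta>" "card \<tau> = 3" "v \<in> \<tau>" using complexD(4)[OF \<sigma>(1)] \<sigma> finS by auto
      then show "\<tau> \<in> {\<tau> \<in> ?T. \<tau> \<subseteq> \<sigma>}" using w by (simp add: cofaces_def Diff_subset)
    qed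
    moreover have "inj_on (\<lambda>w. \<sigma> - {w}) (\<sigma> - {v})" unfolding inj_on_def by blast
    ultimately show "card {\<tau> \<in> ?T. \<tau> \<subseteq> \<sigma>} = 3" using \<sigma> finS by (simp add: card_image)
  qed simp
  finally show ?thesis by simp
qed

sublocale eulerian_graph "vertex_set \<Delta>" adj
proof
  show "card \<sigma> \<le> 4" if "clique \<sigma>" for \<sigma> using that card_face_le unfolding clique_iff by blast
  show "K4 \<sigma> \<noteq> {}" if "clique \<sigma>" for \<sigma>
  proof -
    have "\<sigma> \<in> \<Delta>" using that by (simp add: clique_iff)
    then obtain \<tau> where "\<tau> \<in> \<Delta>" "\<sigma> \<subseteq> \<tau>" "face_dim \<tau> = complex_dim \<Delta>"
      by (rule pure_coface[OF complex pure])
    then have "\<tau> \<in> K4 \<sigma>" by (simp add: K4_eq dim3 face_dim_def)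
    then show ?thesis by blast
  qed
  show "card (nbrs \<tau>) = 2" if "clique \<tau>" "card \<tau> = 3" for \<tau>
    using that card_nbrs_triangle' unfolding clique_iff by blast
  show "card (K4 {v}) + 4 = 2 * card (nbrs {v})" if "v \<in> vertex_set \<Delta>" for v
  proof -
    have v: "{v} \<in> \<Delta>" using that complexD(4) unfolding vertex_set_def by blast
    have K: "cofaces \<Delta> {v} 3 = K4 {v}" unfolding K4_eq cofaces_def by auto
    have "{- 1..3 - int (card {v})} = {- 1, 0, 1, 2}" by auto
    \<comment> \<open>In the link of \<open>v\<close>, vertices minus edges plus triangles is 2.
      Twice the edges being three times the triangles, there are \<open>2 * deg v - 4\<close>
      triangles.\<close>
    then have "int (card (cofaces \<Delta> {v} 1)) - int (card (cofaces \<Delta> {v} 2))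
        + int (card (cofaces \<Delta> {v} 3)) = 2"
      using eulerian_link_count[OF complex eulerian v] cofaces_0[OF v]
      by (simp add: dim3 neg_one_pow_def numeral_2_eq_2 numeral_3_eq_3)
    then show ?thesis
      using card_K4_triangle_vertex[of v] card_cofaces_1[OF v] unfolding K by linarith
  qed
qed

lemma sum_deg_edge_count: "(\<Sum>v\<in>vertex_set \<Delta>. deg v) = 2 * edge_count \<Delta>"
proof -
  define D where "D = {\<sigma> \<in> \<Delta>. card \<sigma> = 2}"
  have fin: "finite D" using complexD(1) by (simp add: D_def)
  have "deg v = card {\<sigma> \<in> D. v \<in> \<sigma>}" if "v \<in> vertex_set \<Delta>" for v
  proof -
    have v: "{v} \<in> \<Delta>" using that complexD(4) unfolding vertex_set_def by blast
    have "cofaces \<Delta> {v} 1 = {\<sigma> \<in> D. v \<in> \<sigma>}" by (auto simp: cofaces_def D_def)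
    then show ?thesis using card_cofaces_1[OF v] by simp
  qed
  then have "(\<Sum>v\<in>vertex_set \<Delta>. deg v) = (\<Sum>v\<in>vertex_set \<Delta>. card {\<sigma> \<in> D. v \<in> \<sigma>})"
    by (intro sum.cong) auto
  also have "\<dots> = (\<Sum>\<sigma>\<in>D. card {v \<in> vertex_set \<Delta>. v \<in> \<sigma>})"
    using sum.swap_restrict[OF finite_vertex_set fin, of "\<lambda>_ _. 1::nat" "(\<in>)"] by simp
  also have "\<dots> = (\<Sum>\<sigma>\<in>D. 2)"
  proof (rule sum.cong)
    fix \<sigma> assume \<sigma>: "\<sigma> \<in> D"
    then have "{v \<in> vertex_set \<Delta>. v \<in> \<sigma>} = \<sigma>" unfolding D_def vertex_set_def by blast
    then show "card {v \<in> vertex_set \<Delta>. v \<in> \<sigma>} = 2" using \<sigma> by (simp add: D_def)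
  qed simp
  finally show ?thesis by (simp add: D_def edge_count_def face_dim_def)
qed

end

section \<open>Joins of cycles\<close>

text \<open>Two different positions could give the same edge only if each were the cyclic successor
  of the other, which is impossible beyond length 2.\<close>

lemma card_cycle_complex_edges:
  assumes d: "distinct xs" and len: "length xs \<ge> 3"
  shows "card {\<sigma> \<in> cycle_complex xs. card \<sigma> = 2} = length xs"
proof -
  let ?n = "length xs"
  define e where "e i = {xs ! i, xs ! (Suc i mod ?n)}" for i
  have lt: "Suc i mod ?n < ?n" for i by (rule mod_less_divisor) (use len in linarith)
  have ne: "i \<noteq> Suc i mod ?n" if "i < ?n" for i
    using that len unfolding Suc_mod_less[OF that] by (cases "Suc i = ?n") simp_all
  have nth_eq: "xs ! i = xs ! j \<longleftrightarrow> i = j" if "i < ?n" "j < ?n" for i j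
    using d that by (simp add: nth_eq_iff_index_eq)
  have card2: "card (e i) = 2" if i: "i < ?n" for i
    using ne[OF i] nth_eq[OF i lt] by (simp add: e_def)
  have "{\<sigma> \<in> cycle_complex xs. card \<sigma> = 2} = e ` {..<?n}"
  proof (intro set_eqI iffI)
    fix \<sigma> assume "\<sigma> \<in> {\<sigma> \<in> cycle_complex xs. card \<sigma> = 2}"
    then have "\<sigma> \<in> cycle_complex xs" "card \<sigma> = 2" by simp_all
    then show "\<sigma> \<in> e ` {..<?n}" unfolding cycle_complex_def e_def by (auto simp: image_iff)
  next
    fix \<sigma> assume "\<sigma> \<in> e ` {..<?n}"
    then obtain i where "i < ?n" "\<sigma> = e i" by blast
    then show "\<sigma> \<in> {\<sigma> \<in> cycle_complex xs. card \<sigma> = 2}"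
      using card2[of i] unfolding cycle_complex_def e_def by blast
  qed
  moreover have "inj_on e {..<?n}"
  proof (rule inj_onI)
    fix i j assume i: "i \<in> {..<?n}" and j: "j \<in> {..<?n}" and eq: "e i = e j"
    then have i': "i < ?n" and j': "j < ?n" by simp_all
    have "i = j \<or> i = Suc j mod ?n \<and> Suc i mod ?n = j"
      using eq nth_eq[OF i' j'] nth_eq[OF i' lt] nth_eq[OF lt j'] unfolding e_def doubleton_eq_iff
      by blast
    then show "i = j"
    proof
      assume a: "i = Suc j mod ?n \<and> Suc i mod ?n = j"
      have "Suc j = ?n \<and> i = 0 \<or> i = Suc j" "Suc i = ?n \<and> j = 0 \<or> j = Suc i"
        using a Suc_mod_less[OF i'] Suc_mod_less[OF j'] by argo+
      then show "i = j" using len by linarith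
    qed
  qed
  ultimately show ?thesis by (simp add: card_image)
qed

text \<open>An edge of the join lies in one of the factors (\<open>A\<close>, \<open>B\<close>) or
  connects a vertex of one to a vertex of the other (\<open>C\<close>).\<close>

lemma edge_count_join_cycles:
  assumes x: "distinct xs" "length xs \<ge> 3" and y: "distinct ys" "length ys \<ge> 3"
    and disj: "set xs \<inter> set ys = {}"
  shows "edge_count (complex_join (cycle_complex xs) (cycle_complex ys)) =
    length xs * length ys + (length xs + length ys)"
proof -
  define A where "A = {\<sigma> \<in> cycle_complex xs. card \<sigma> = 2}"
  define B where "B = {\<sigma> \<in> cycle_complex ys. card \<sigma> = 2}"
  define C where "C = (\<lambda>(u, v). {u, v}) ` (set xs \<times> set ys)"
  have empty: "{} \<in> cycle_complex zs" for zs :: "'a list" by (simp add: cycle_complex_def)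
  have single: "{z} \<in> cycle_complex zs \<longleftrightarrow> z \<in> set zs" for z and zs :: "'a list"
    using cycle_complex_subset[of "{z}" zs] by (auto simp: cycle_complex_def)
  have sub: "\<sigma> \<subseteq> set xs" if "\<sigma> \<in> A" for \<sigma> using that cycle_complex_subset unfolding A_def by blast
  have sub': "\<sigma> \<subseteq> set ys" if "\<sigma> \<in> B" for \<sigma> using that cycle_complex_subset unfolding B_def by blast
  have fin: "finite A" "finite B" "finite C"
    using finite_subset[of A "Pow (set xs)"] finite_subset[of B "Pow (set ys)"] sub sub'
    by (auto simp: C_def)
  have "{\<rho> \<in> complex_join (cycle_complex xs) (cycle_complex ys). card \<rho> = 2} = A \<union> B \<union> C"
  proof (intro set_eqI iffI)
    fix \<rho> assume "\<rho> \<in> {\<rho> \<in> complex_join (cycle_complex xs) (cycle_complex ys). card \<rho> = 2}"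
    then obtain \<sigma> \<tau> where st: "\<sigma> \<in> cycle_complex xs" "\<tau> \<in> cycle_complex ys" "\<rho> = \<sigma> \<union> \<tau>"
      and c: "card \<rho> = 2" unfolding complex_join_def by blast
    note s = cycle_complex_subset[OF st(1)] and t = cycle_complex_subset[OF st(2)]
    have f: "finite \<sigma>" "finite \<tau>" using s t finite_subset by blast+
    have "card \<sigma> + card \<tau> = 2" using card_Un_disjoint[OF f] s t disj c st(3) by auto
    then consider "card \<sigma> = 2" "card \<tau> = 0" | "card \<sigma> = 0" "card \<tau> = 2" | "card \<sigma> = 1" "card \<tau> = 1"
      by linarith
    then show "\<rho> \<in> A \<union> B \<union> C"
    proof cases
      case 1
      then have "\<rho> = \<sigma>" using f st(3) by simp
      then show ?thesis using 1 st(1) by (simp add: A_def)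
    next
      case 2
      then have "\<rho> = \<tau>" using f st(3) by simp
      then show ?thesis using 2 st(2) by (simp add: B_def)
    next
      case 3
      then obtain u v where "\<sigma> = {u}" "\<tau> = {v}" by (meson card_1_singletonE)
      then have "\<rho> = {u, v}" "u \<in> set xs" "v \<in> set ys" using st(3) s t by auto
      then show ?thesis unfolding C_def by blast
    qed
  next
    fix \<rho> assume "\<rho> \<in> A \<union> B \<union> C"
    then consider "\<rho> \<in> A" | "\<rho> \<in> B" | u v where "u \<in> set xs" "v \<in> set ys" "\<rho> = {u, v}"
      unfolding C_def by blast
    then show "\<rho> \<in> {\<rho> \<in> complex_join (cycle_complex xs) (cycle_complex ys). card \<rho> = 2}"
    proof cases
      case 1
      then have "\<rho> = \<rho> \<union> {}" "\<rho> \<in> cycle_complex xs" "card \<rho> = 2" by (simp_all add: A_def)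
      then show ?thesis using empty[of ys] unfolding complex_join_def by blast
    next
      case 2
      then have "\<rho> = {} \<union> \<rho>" "\<rho> \<in> cycle_complex ys" "card \<rho> = 2" by (simp_all add: B_def)
      then show ?thesis using empty[of xs] unfolding complex_join_def by blast
    next
      case (3 u v)
      then have "\<rho> = {u} \<union> {v}" "card \<rho> = 2" using disj by (auto simp: card_insert_if)
      moreover have "{u} \<in> cycle_complex xs" "{v} \<in> cycle_complex ys" using 3 single by simp_all
      ultimately show ?thesis unfolding complex_join_def by blast
    qed
  qed
  moreover have "A \<inter> B = {}"
  proof -
    have "\<sigma> = {}" if "\<sigma> \<in> A" "\<sigma> \<in> B" for \<sigma> using sub[OF that(1)] sub'[OF that(2)] disj by blast
    then show ?thesis by (force simp: A_def)
  qed
  moreover have "(A \<union> B) \<inter> C = {}"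
  proof -
    have False if "\<sigma> \<in> A \<union> B" "\<sigma> \<in> C" for \<sigma>
    proof -
      obtain u v where "u \<in> set xs" "v \<in> set ys" "\<sigma> = {u, v}" using \<open>\<sigma> \<in> C\<close> by (auto simp: C_def)
      then show False using sub[of \<sigma>] sub'[of \<sigma>] \<open>\<sigma> \<in> A \<union> B\<close> disj by blast
    qed
    then show ?thesis by blast
  qed
  moreover have "card C = length xs * length ys"
  proof -
    have "inj_on (\<lambda>(u, v). {u, v}) (set xs \<times> set ys)"
      using disj unfolding inj_on_def by (auto simp: doubleton_eq_iff)
    then show ?thesis
      unfolding C_def using x y by (simp add: card_image card_cartesian_product distinct_card)
  qed
  moreover have "card A = length xs" "card B = length ys"
    unfolding A_def B_def using card_cycle_complex_edges x y by blast+
  ultimately have "card {\<rho> \<in> complex_join (cycle_complex xs) (cycle_complex ys). card \<rho> = 2}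
      = length xs * length ys + (length xs + length ys)"
    using fin by (simp add: card_Un_disjoint)
  then show ?thesis unfolding edge_count_def face_dim_def by simp
qed

lemma edge_count_J2:
  assumes "n \<ge> 6"
  shows "edge_count (J2 n) = (n div 2) * ((n + 1) div 2) + n"
proof -
  have "n - n div 2 = (n + 1) div 2" "n div 2 + (n + 1) div 2 = n" by linarith+
  moreover have "n div 2 \<ge> 3" "(n + 1) div 2 \<ge> 3" using assms by linarith+
  ultimately show ?thesis
    unfolding J2_def using edge_count_join_cycles[of "[0..<n div 2]" "[n div 2..<n]"] by auto
qed

text \<open>A clique splits into its traces on \<open>W1\<close> and \<open>W2\<close>, and
  conversely any two cliques of the parts unite to a clique. So \<open>\<Delta>\<close> is the join
  of two clique complexes, each a union of cycles, and joins distribute over unions.\<close>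

lemma join_mem_GJ:
  assumes n: "n \<ge> 8" and W: "W1 \<inter> W2 = {}" "W1 \<noteq> {}" "W2 \<noteq> {}"
    and reg: "two_regular W1 E" "two_regular W2 E"
    and card: "card W1 = n div 2" "card W2 = (n + 1) div 2"
    and join: "\<And>x y. x \<in> W1 \<Longrightarrow> y \<in> W2 \<Longrightarrow> E x y"
    and \<Delta>: "\<Delta> = {\<tau>. \<tau> \<subseteq> W1 \<union> W2 \<and> (\<forall>x\<in>\<tau>. \<forall>y\<in>\<tau>. x \<noteq> y \<longrightarrow> E x y)}"
  shows "\<Delta> \<in> GJ n"
proof -
  have sym: "E y x" if "E x y" for x y using two_regular.sym[OF reg(1) that] .
  obtain s :: nat and L where L: "\<forall>i\<in>{1..s}. distinct (L i) \<and> length (L i) \<ge> 4"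
    "disjoint_family_on (\<lambda>i. set (L i)) {1..s}" "(\<Union>i\<in>{1..s}. set (L i)) = W1"
    "{\<tau>. \<tau> \<subseteq> W1 \<and> (\<forall>x\<in>\<tau>. \<forall>y\<in>\<tau>. x \<noteq> y \<longrightarrow> E x y)} = (\<Union>i\<in>{1..s}. cycle_complex (L i))"
    by (rule two_regular_cycles[OF reg(1) W(2)])
  obtain t :: nat and M where M: "\<forall>i\<in>{1..t}. distinct (M i) \<and> length (M i) \<ge> 4"
    "disjoint_family_on (\<lambda>i. set (M i)) {1..t}" "(\<Union>i\<in>{1..t}. set (M i)) = W2"
    "{\<tau>. \<tau> \<subseteq> W2 \<and> (\<forall>x\<in>\<tau>. \<forall>y\<in>\<tau>. x \<noteq> y \<longrightarrow> E x y)} = (\<Union>i\<in>{1..t}. cycle_complex (M i))"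
    by (rule two_regular_cycles[OF reg(2) W(3)])
  have vs: "vertex_set (cycle_complex (L i)) = set (L i)" if "i \<in> {1..s}" for i
    using L(1) that by (intro vertex_set_cycle_complex) force
  have vt: "vertex_set (cycle_complex (M i)) = set (M i)" if "i \<in> {1..t}" for i
    using M(1) that by (intro vertex_set_cycle_complex) force
  have cyc: "is_cycle (length zs) (cycle_complex zs)" if "distinct zs" "length zs \<ge> 4" for zs :: "'a list"
    using that unfolding is_cycle_def by auto
  have sumL: "(\<Sum>i = 1..s. length (L i)) = n div 2"
  proof -
    have "card W1 = (\<Sum>i\<in>{1..s}. card (set (L i)))"
      unfolding L(3)[symmetric] using L(2) by (intro card_UN_disjoint) (auto simp: disjoint_family_on_def)
    also have "\<dots> = (\<Sum>i = 1..s. length (L i))"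
      using L(1) by (intro sum.cong) (simp_all add: distinct_card)
    finally show ?thesis using card(1) by simp
  qed
  have sumM: "(\<Sum>i = 1..t. length (M i)) = (n + 1) div 2"
  proof -
    have "card W2 = (\<Sum>i\<in>{1..t}. card (set (M i)))"
      unfolding M(3)[symmetric] using M(2) by (intro card_UN_disjoint) (auto simp: disjoint_family_on_def)
    also have "\<dots> = (\<Sum>i = 1..t. length (M i))"
      using M(1) by (intro sum.cong) (simp_all add: distinct_card)
    finally show ?thesis using card(2) by simp
  qed
  have "\<Delta> = complex_join (\<Union>i\<in>{1..s}. cycle_complex (L i)) (\<Union>j\<in>{1..t}. cycle_complex (M j))"
    unfolding L(4)[symmetric] M(4)[symmetric]
  proof (intro set_eqI iffI)
    fix \<rho> assume "\<rho> \<in> \<Delta>"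
    then have \<rho>: "\<rho> \<subseteq> W1 \<union> W2" "\<forall>x\<in>\<rho>. \<forall>y\<in>\<rho>. x \<noteq> y \<longrightarrow> E x y" unfolding \<Delta> by blast+
    then have "\<rho> = (\<rho> \<inter> W1) \<union> (\<rho> \<inter> W2)" by blast
    then show "\<rho> \<in> complex_join {\<tau>. \<tau> \<subseteq> W1 \<and> (\<forall>x\<in>\<tau>. \<forall>y\<in>\<tau>. x \<noteq> y \<longrightarrow> E x y)}
        {\<tau>. \<tau> \<subseteq> W2 \<and> (\<forall>x\<in>\<tau>. \<forall>y\<in>\<tau>. x \<noteq> y \<longrightarrow> E x y)}"
      using \<rho>(2) unfolding complex_join_def by blast
  next
    fix \<rho> assume "\<rho> \<in> complex_join {\<tau>. \<tau> \<subseteq> W1 \<and> (\<forall>x\<in>\<tau>. \<forall>y\<in>\<tau>. x \<noteq> y \<longrightarrow> E x y)}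
        {\<tau>. \<tau> \<subseteq> W2 \<and> (\<forall>x\<in>\<tau>. \<forall>y\<in>\<tau>. x \<noteq> y \<longrightarrow> E x y)}"
    then obtain \<sigma> \<tau> where st: "\<rho> = \<sigma> \<union> \<tau>" "\<sigma> \<subseteq> W1" "\<tau> \<subseteq> W2"
      "\<forall>x\<in>\<sigma>. \<forall>y\<in>\<sigma>. x \<noteq> y \<longrightarrow> E x y" "\<forall>x\<in>\<tau>. \<forall>y\<in>\<tau>. x \<noteq> y \<longrightarrow> E x y"
      unfolding complex_join_def by blast
    have "E x y" if xy: "x \<in> \<rho>" "y \<in> \<rho>" "x \<noteq> y" for x y
    proof -
      consider "x \<in> \<sigma>" "y \<in> \<sigma>" | "x \<in> \<tau>" "y \<in> \<tau>" | "x \<in> \<sigma>" "y \<in> \<tau>" | "x \<in> \<tau>" "y \<in> \<sigma>"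
        using xy st(1) by blast
      then show ?thesis
      proof cases
        case 1 then show ?thesis using st(4) xy by blast
      next
        case 2 then show ?thesis using st(5) xy by blast
      next
        case 3 then show ?thesis using join st(2,3) by blast
      next
        case 4
        then have "E y x" using join st(2,3) by blast
        then show ?thesis by (rule sym)
      qed
    qed
    then show "\<rho> \<in> \<Delta>" unfolding \<Delta> using st(1-3) by blast
  qed
  also have "\<dots> = (\<Union>i\<in>{1..s}. \<Union>j\<in>{1..t}. complex_join (cycle_complex (L i)) (cycle_complex (M j)))"
    unfolding complex_join_def by blast
  finally have \<Delta>': "\<Delta> = \<dots>" .
  show ?thesis
    unfolding GJ_def mem_Collect_eq
  proof (intro conjI exI)
    show "\<forall>i\<in>{1..s}. 4 \<le> length (L i) \<and> is_cycle (length (L i)) (cycle_complex (L i))"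
      using L(1) cyc by blast
    show "\<forall>j\<in>{1..t}. 4 \<le> length (M j) \<and> is_cycle (length (M j)) (cycle_complex (M j))"
      using M(1) cyc by blast
    show "disjoint_family_on (\<lambda>i. vertex_set (cycle_complex (L i))) {1..s}"
      using L(2) vs unfolding disjoint_family_on_def by simp
    show "disjoint_family_on (\<lambda>j. vertex_set (cycle_complex (M j))) {1..t}"
      using M(2) vt unfolding disjoint_family_on_def by simp
    show "\<forall>i\<in>{1..s}. \<forall>j\<in>{1..t}.
        vertex_set (cycle_complex (L i)) \<inter> vertex_set (cycle_complex (M j)) = {}"
    proof (intro ballI)
      fix i j assume ij: "i \<in> {1..s}" "j \<in> {1..t}"
      then have "set (L i) \<subseteq> W1" "set (M j) \<subseteq> W2" using L(3) M(3) by blast+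
      then show "vertex_set (cycle_complex (L i)) \<inter> vertex_set (cycle_complex (M j)) = {}"
        unfolding vs[OF ij(1)] vt[OF ij(2)] using W(1) by blast
    qed
  qed (fact n sumL sumM \<Delta>')+
qed

theorem theorem5p10:
  fixes \<Delta> :: "'a set set" and n :: nat
  assumes "is_simplicial_complex \<Delta>"
    and "flag_complex \<Delta>"
    and "complex_dim \<Delta> = 3"
    and "eulerian_complex TYPE('k::field) \<Delta>"
    and "card (vertex_set \<Delta>) = n"
    and "edge_count \<Delta> = edge_count (J2 n)"
  shows "\<Delta> \<in> GJ n"
proof -
  interpret flag_eulerian_3 \<Delta> "TYPE('k)" using assms(1-4) by unfold_locales
  \<comment> \<open>This precedes the interpretation of \<open>extremal_graph\<close>, since the
    edge count of \<open>J2 n\<close> was computed for \<open>n \<ge> 6\<close>.\<close>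
  have n8: "n \<ge> 8" using card_V_ge8 assms(5) by simp
  interpret extremal_graph "vertex_set \<Delta>" adj
    using n8 by unfold_locales (simp add: sum_deg_edge_count assms(5,6) edge_count_J2)
  obtain V1 V2 where V: "vertex_set \<Delta> = V1 \<union> V2" "V1 \<inter> V2 = {}"
    and join: "\<forall>x\<in>V1. \<forall>y\<in>V2. adj x y"
    and reg: "\<forall>x\<in>V1. card {y \<in> V1. adj x y} = 2" "\<forall>x\<in>V2. card {y \<in> V2. adj x y} = 2"
    and card: "card V1 = card (vertex_set \<Delta>) div 2" "card V2 = (card (vertex_set \<Delta>) + 1) div 2"
    by (rule join_decomposition)
  have fin: "finite V1" "finite V2" using finite_vertex_set unfolding V(1) by simp_all
  have join': "adj x y" if "x \<in> V1" "y \<in> V2" for x y using join that by blast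
  have ne: "V1 \<noteq> {}" "V2 \<noteq> {}" using card n8 assms(5) by auto
  \<comment> \<open>Triangle-freeness holds because a triangle in one side and an edge of the other
    would form a 5-clique.\<close>
  have regular: "two_regular W adj"
    if W: "finite W" "\<And>x. x \<in> W \<Longrightarrow> card {y \<in> W. adj x y} = 2"
      and U: "U \<noteq> {}" "\<And>x. x \<in> U \<Longrightarrow> card {y \<in> U. adj x y} = 2"
      and WU: "\<And>x y. x \<in> W \<Longrightarrow> y \<in> U \<Longrightarrow> adj x y" for W U
  proof
    fix x y z assume xyz: "x \<in> W" "y \<in> W" "z \<in> W" "adj x y" "adj y z" "adj z x"
    obtain u where u: "u \<in> U" using U(1) by blast
    have "{y \<in> U. adj u y} \<noteq> {}" using U(2)[OF u] by (metis card.empty zero_neq_numeral)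
    then obtain w where w: "w \<in> U" "adj u w" by blast
    have "{x, y, z, u} \<in> K4 {}"
      by (rule K4_I[OF xyz(4) E_sym[OF xyz(6)] WU xyz(5) WU WU]) fact+
    then have "nbrs {x, y, z, u} = {}" using no_K5 K4_D by blast
    moreover have "w \<in> nbrs {x, y, z, u}"
      using WU[OF xyz(1) w(1)] WU[OF xyz(2) w(1)] WU[OF xyz(3) w(1)] w(2) E_V2[OF w(2)]
      by (simp add: nbrs_def)
    ultimately show False by blast
  qed (fact W E_sym E_irrefl)+
  show ?thesis
  proof (rule join_mem_GJ[OF n8 V(2) ne])
    show "two_regular V1 adj"
      by (rule regular[OF fin(1) bspec[OF reg(1)] ne(2) bspec[OF reg(2)] join'])
    show "two_regular V2 adj"
      by (rule regular[OF fin(2) bspec[OF reg(2)] ne(1) bspec[OF reg(1)] E_sym[OF join']])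
    show "adj x y" if "x \<in> V1" "y \<in> V2" for x y using that by (rule join')
    show "\<Delta> = {\<tau>. \<tau> \<subseteq> V1 \<union> V2 \<and> (\<forall>x\<in>\<tau>. \<forall>y\<in>\<tau>. x \<noteq> y \<longrightarrow> adj x y)}"
      unfolding V(1)[symmetric] using clique_iff unfolding clique_def by blast
  qed (use card assms(5) in simp_all)
qed

end
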